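(* For every $\alpha \in [3,\omega]$ (i.e. $\alpha\in\{3,4,5,\dots\}\cup\{\omega\}$), the elementary theory $\mathbf{Th}(\mathsf{W}^N_\alpha,\prec,\Diamond_1,\Diamond_3)$ is undecidable.
   Context: Words are finite strings over the alphabet $\mathbb{N}=\{0,1,2,\dots\}$; $\mathsf{W}_\omega$ is the set of all words, $\Lambda$ the empty word, $AB$ the concatenation of $A$ and $B$. For $k\in\mathbb{N}$, $\mathsf{S}_k$ is the set of words all of whose symbols are $\ge k$; for $\alpha\in\mathbb{N}\cup\{\omega\}$, $\mathsf{W}_\alpha$ is the set of words all of whose symbols are $\le\alpha$ ($\mathsf{W}_\omega$ = all words). Given a linear preorder $\precsim$ with $A\sim B$ iff $A\precsim B\wedge B\precsim A$ and $A\prec B$ iff $A\precsim B\wedge\neg B\precsim A$, a finite sequence $(A_1,\dots,A_p)$ is lexicographically not greater than $(B_1,\dots,B_q)$ iff either $p\le q$ and $A_i\sim B_i$ for all $i\le p$, or there is $s<\min(p,q)$ with $A_i\sim B_i$ for $i\le s$ and $A_{s+1}\prec B_{s+1}$. A lexicographically maximal subsequence of a finite sequence is a subsequence (obtained by selecting positions in increasing order) that is lexicographically not less than every subsequence. The linear preorder $\precsim$ on $\mathsf{W}_\omega$ is defined by recursion on (largest symbol of $AB$) $-$ (smallest symbol of $AB$): $\Lambda\precsim\Lambda$; if $AB$ is nonempty with minimal symbol $n$, write uniquely $A=A_1nA_2n\cdots nA_k$, $B=B_1n\cdots nB_l$ ($k,l\ge1$) with all $A_i,B_j\in\mathsf{S}_{n+1}$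 (possibly empty); let $C,D$ be lexicographically maximal subsequences of $(A_1,\dots,A_k)$, $(B_1,\dots,B_l)$ (comparisons among the $A_i,B_j$ being already defined); then $A\precsim B$ iff $C$ is lexicographically not greater than $D$. This yields a linear preorder. The set $\mathsf{NF}$ of normal forms: $\Lambda\in\mathsf{NF}$; a word with minimal symbol $n$, written $A_1n\cdots nA_k$ with $k\ge2$ and $A_i\in\mathsf{S}_{n+1}$, is in $\mathsf{NF}$ iff $A_k\precsim A_{k-1}\precsim\dots\precsim A_1$ and every $A_i\in\mathsf{NF}$. Every word is $\sim$-equivalent to exactly one word of $\mathsf{NF}$, and $\prec$ is a strict linear order on $\mathsf{NF}$. For $n\in\mathbb{N}$ and $A\in\mathsf{NF}$, $\Diamond_n A$ is the unique word of $\mathsf{NF}$ that is $\sim$-equivalent to $An$. $\mathsf{W}^N_\alpha=\mathsf{W}_\alpha\cap\mathsf{NF}$; it is closed under $\Diamond_i$ for $i\le\alpha$. $\mathbf{Th}(\mathfrak{M})$ denotes the set of first-order sentences (in the signature of $\mathfrak{M}$, with equality) true in $\mathfrak{M}$; decidable means recursive. *)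

theory Defs
  imports Main "HOL-Library.Sublist" "HOL-Library.Nat_Bijection" "HOL-Library.Extended_Nat"
begin

type_synonym word = "nat list"

fun split_at_sym :: "nat \<Rightarrow> word \<Rightarrow> word list" where
  "split_at_sym n [] = [[]]"
| "split_at_sym n (x # xs) =
     (if x = n then [] # split_at_sym n xs
      else (case split_at_sym n xs of [] \<Rightarrow> [[x]] | (y # ys) \<Rightarrow> (x # y) # ys))"

definition psim :: "('a \<Rightarrow> 'a \<Rightarrow> bool) \<Rightarrow> 'a \<Rightarrow> 'a \<Rightarrow> bool" where
  "psim le a b \<longleftrightarrow> le a b \<and> le b a"

definition pless :: "('a \<Rightarrow> 'a \<Rightarrow> bool) \<Rightarrow> 'a \<Rightarrow> 'a \<Rightarrow> bool" where
  "pless le a b \<longleftrightarrow> le a b \<and> \<not> le b a"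

definition lexle :: "('a \<Rightarrow> 'a \<Rightarrow> bool) \<Rightarrow> 'a list \<Rightarrow> 'a list \<Rightarrow> bool" where
  "lexle le xs ys \<longleftrightarrow>
     (length xs \<le> length ys \<and> (\<forall>i < length xs. psim le (xs ! i) (ys ! i)))
   \<or> (\<exists>s < min (length xs) (length ys).
        (\<forall>i < s. psim le (xs ! i) (ys ! i)) \<and> pless le (xs ! s) (ys ! s))"

definition lexmax_subseq :: "('a \<Rightarrow> 'a \<Rightarrow> bool) \<Rightarrow> 'a list \<Rightarrow> 'a list \<Rightarrow> bool" where
  "lexmax_subseq le xs C \<longleftrightarrow>
     subseq C xs \<and> (\<forall>D. subseq D xs \<longrightarrow> \<not> pless (lexle le) C D)"

(* measure for the recursion: (largest symbol) - (smallest symbol) of a word, shifted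
   by one so that the empty word gets 0 *)
definition wmeasure :: "word \<Rightarrow> nat" where
  "wmeasure w = (if w = [] then 0 else Max (set w) - Min (set w) + 1)"

(* The recursive definition, with fuel; the fuel wmeasure(AB) always suffices
   since the pieces A_i, B_j (and their pairwise concatenations) have strictly
   smaller measure. *)
primrec wle_aux :: "nat \<Rightarrow> word \<Rightarrow> word \<Rightarrow> bool" where
  "wle_aux 0 A B = True"
| "wle_aux (Suc k) A B =
     (if A @ B = [] then True
      else (let n = Min (set (A @ B));
                le = wle_aux k;
                C = (SOME C. lexmax_subseq le (split_at_sym n A) C);
                D = (SOME D. lexmax_subseq le (split_at_sym n B) D)
            in lexle le C D))"

definition wle :: "word \<Rightarrow> word \<Rightarrow> bool" where
  "wle A B = wle_aux (wmeasure (A @ B)) A B"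

definition wsim :: "word \<Rightarrow> word \<Rightarrow> bool" where
  "wsim A B \<longleftrightarrow> wle A B \<and> wle B A"

definition wless :: "word \<Rightarrow> word \<Rightarrow> bool" where
  "wless A B \<longleftrightarrow> wle A B \<and> \<not> wle B A"

inductive NF :: "word \<Rightarrow> bool" where
  NF_Nil: "NF []"
| NF_split: "\<lbrakk> w \<noteq> []; ps = split_at_sym (Min (set w)) w; length ps \<ge> 2;
              \<forall>i. Suc i < length ps \<longrightarrow> wle (ps ! Suc i) (ps ! i);
              \<forall>p \<in> set ps. NF p \<rbrakk> \<Longrightarrow> NF w"

definition diam :: "nat \<Rightarrow> word \<Rightarrow> word" where
  "diam n A = (THE B. NF B \<and> wsim B (A @ [n]))"

definition W :: "enat \<Rightarrow> word set" where
  "W \<alpha> = {w. \<forall>x \<in> set w. enat x \<le> \<alpha>}"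

definition WN :: "enat \<Rightarrow> word set" where
  "WN \<alpha> = W \<alpha> \<inter> {w. NF w}"

datatype tm = Var nat | F1 tm | F3 tm

datatype fm = Eq tm tm | Lt tm tm | Neg fm | Conj fm fm | Ex nat fm

primrec tvars :: "tm \<Rightarrow> nat set" where
  "tvars (Var i) = {i}"
| "tvars (F1 t) = tvars t"
| "tvars (F3 t) = tvars t"

primrec freevars :: "fm \<Rightarrow> nat set" where
  "freevars (Eq s t) = tvars s \<union> tvars t"
| "freevars (Lt s t) = tvars s \<union> tvars t"
| "freevars (Neg f) = freevars f"
| "freevars (Conj f g) = freevars f \<union> freevars g"
| "freevars (Ex i f) = freevars f - {i}"

definition sentence :: "fm \<Rightarrow> bool" where
  "sentence f \<longleftrightarrow> freevars f = {}"

primrec teval :: "('a \<Rightarrow> 'a) \<Rightarrow> ('a \<Rightarrow> 'a) \<Rightarrow> (nat \<Rightarrow> 'a) \<Rightarrow> tm \<Rightarrow> 'a" where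
  "teval g1 g3 v (Var i) = v i"
| "teval g1 g3 v (F1 t) = g1 (teval g1 g3 v t)"
| "teval g1 g3 v (F3 t) = g3 (teval g1 g3 v t)"

primrec sat :: "'a set \<Rightarrow> ('a \<Rightarrow> 'a \<Rightarrow> bool) \<Rightarrow> ('a \<Rightarrow> 'a) \<Rightarrow> ('a \<Rightarrow> 'a)
                \<Rightarrow> (nat \<Rightarrow> 'a) \<Rightarrow> fm \<Rightarrow> bool" where
  "sat M lt g1 g3 v (Eq s t) = (teval g1 g3 v s = teval g1 g3 v t)"
| "sat M lt g1 g3 v (Lt s t) = lt (teval g1 g3 v s) (teval g1 g3 v t)"
| "sat M lt g1 g3 v (Neg f) = (\<not> sat M lt g1 g3 v f)"
| "sat M lt g1 g3 v (Conj f g) = (sat M lt g1 g3 v f \<and> sat M lt g1 g3 v g)"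
| "sat M lt g1 g3 v (Ex i f) = (\<exists>a \<in> M. sat M lt g1 g3 (v(i := a)) f)"

(* Th(M, lt, g1, g3): sentences true in the structure (assignments range over M;
   irrelevant for sentences, but we quantify over all assignments into M) *)
definition Th :: "'a set \<Rightarrow> ('a \<Rightarrow> 'a \<Rightarrow> bool) \<Rightarrow> ('a \<Rightarrow> 'a) \<Rightarrow> ('a \<Rightarrow> 'a) \<Rightarrow> fm set" where
  "Th M lt g1 g3 = {f. sentence f \<and> (\<forall>v. (\<forall>i. v i \<in> M) \<longrightarrow> sat M lt g1 g3 v f)}"

primrec enc_tm :: "tm \<Rightarrow> nat" where
  "enc_tm (Var i) = prod_encode (0, i)"
| "enc_tm (F1 t) = prod_encode (1, enc_tm t)"
| "enc_tm (F3 t) = prod_encode (2, enc_tm t)"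

primrec enc_fm :: "fm \<Rightarrow> nat" where
  "enc_fm (Eq s t) = prod_encode (0, prod_encode (enc_tm s, enc_tm t))"
| "enc_fm (Lt s t) = prod_encode (1, prod_encode (enc_tm s, enc_tm t))"
| "enc_fm (Neg f) = prod_encode (2, enc_fm f)"
| "enc_fm (Conj f g) = prod_encode (3, prod_encode (enc_fm f, enc_fm g))"
| "enc_fm (Ex i f) = prod_encode (4, prod_encode (i, enc_fm f))"

inductive recfn :: "nat \<Rightarrow> (nat list \<Rightarrow> nat) \<Rightarrow> bool" where
  r_zero: "recfn n (\<lambda>xs. 0)"
| r_succ: "recfn 1 (\<lambda>xs. Suc (xs ! 0))"
| r_proj: "i < n \<Longrightarrow> recfn n (\<lambda>xs. xs ! i)"
| r_comp: "\<lbrakk> recfn m f; length gs = m; \<forall>g \<in> set gs. recfn n g \<rbrakk>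
           \<Longrightarrow> recfn n (\<lambda>xs. f (map (\<lambda>g. g xs) gs))"
| r_prim: "\<lbrakk> recfn n f; recfn (Suc (Suc n)) g \<rbrakk>
           \<Longrightarrow> recfn (Suc n) (\<lambda>xs. rec_nat (f (tl xs)) (\<lambda>y r. g (y # r # tl xs)) (hd xs))"
| r_mu: "\<lbrakk> recfn (Suc n) f; \<forall>xs. length xs = n \<longrightarrow> (\<exists>y. f (y # xs) = 0) \<rbrakk>
           \<Longrightarrow> recfn n (\<lambda>xs. LEAST y. f (y # xs) = 0)"

definition decidable_fms :: "fm set \<Rightarrow> bool" where
  "decidable_fms S \<longleftrightarrow> (\<exists>f. recfn 1 f \<and> (\<forall>\<phi>. f [enc_fm \<phi>] = (if \<phi> \<in> S then 1 else 0)))"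

end

theory Submission
  imports Defs
begin

text \<open>
  A normal form is a descending sequence of pieces, and \<open>p\<close> is a nonempty initial segment of the
  sequence \<open>x\<close> iff \<open>p \<preceq> x \<prec> \<Diamond>\<^sub>1 p\<close>. Hence every element \<open>x\<close> determines the finite
  linear order of its initial segments, and \<open>p \<mapsto> \<Diamond>\<^sub>3 p\<close> attaches a label to each of them.
  Two initial segments can carry equal labels, and the words with symbols \<open>\<le> 3\<close> suffice to realize
  every finite sequence over \<open>n\<close> labels. The labels of one element \<open>w\<close>, ordered by \<open>\<prec>\<close>,
  therefore serve as the natural numbers below \<open>n\<close>, and the pairs of labels of consecutive
  initial segments of another element code an arbitrary binary relation on them. So the
  graphs of recursive functions are definable over large enough \<open>w\<close>, where soundness of
  the definitions holds over every \<open>w\<close>, and a diagonal sentence refutes any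
  decision procedure.
\<close>

section \<open>Hereditary lists under the lexicographic order\<close>

text \<open>Two obstacles shape the proof. The pieces of a normal form descend, so a sequence of
  labels cannot be written down directly. Each piece therefore carries a counter besides its label
  data: the counter enforces descent whatever the labels are, and \<open>\<Diamond>\<^sub>3\<close>
  erases it, because the last component with 3 appended dominates everything before it. This takes
  four symbols: 0 separates the pieces, 1 the components of a piece, 2 and 3 write the components.
  The other obstacle is that each \<open>w\<close> holds only finitely many numbers, and the
  formulas do not express that all relations on these numbers are coded. A formula may thus fail in
  a poor \<open>w\<close> although the value is right, and its negation says nothing reliable. So
  representing formulas occur only positively, and the diagonal sentence is existential in
  \<open>w\<close>. Trees enter because \<open>wle\<close> is a preorder defined through arbitrary
  choices of maximal subsequences; a map into a linear order turns \<sim> into equality.\<close>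

datatype tree = Node "tree list"

fun tree_le :: "tree \<Rightarrow> tree \<Rightarrow> bool" where
  "tree_le (Node []) t = True"
| "tree_le (Node (x # xs)) (Node []) = False"
| "tree_le (Node (x # xs)) (Node (y # ys)) =
     (if x = y then tree_le (Node xs) (Node ys) else tree_le x y)"

lemma tree_le_refl: "tree_le t t"
proof (induction "size t" arbitrary: t rule: less_induct)
  case less
  obtain xs where "t = Node xs" by (cases t)
  then show ?case using less by (cases xs) auto
qed

lemma tree_le_antisym: "tree_le s t \<Longrightarrow> tree_le t s \<Longrightarrow> s = t"
proof (induction s t rule: tree_le.induct)
  case (1 t)
  then show ?case by (cases t rule: tree.exhaust, rename_tac xs, case_tac xs) auto
qed (auto split: if_splits)

lemma tree_le_total: "tree_le s t \<or> tree_le t s"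
  by (induction s t rule: tree_le.induct) auto

lemma tree_le_trans: "tree_le s t \<Longrightarrow> tree_le t u \<Longrightarrow> tree_le s u"
proof (induction "size s" arbitrary: s t u rule: less_induct)
  case less
  obtain xs ys zs where e: "s = Node xs" "t = Node ys" "u = Node zs" by (metis tree.exhaust)
  show ?case
  proof (cases xs)
    case Nil then show ?thesis using e by simp
  next
    case (Cons x xs')
    then obtain y ys' where ys: "ys = y # ys'" using less e by (cases ys) auto
    then obtain z zs' where zs: "zs = z # zs'" using less e by (cases zs) auto
    have "x \<noteq> y \<Longrightarrow> y \<noteq> z \<Longrightarrow> x \<noteq> z"
      using less.prems e Cons ys zs tree_le_antisym by auto
    then show ?thesis
      using less.prems less.hyps[of x y z] less.hyps[of "Node xs'" "Node ys'" "Node zs'"] e Cons ys zs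
      by (auto split: if_splits)
  qed
qed

instantiation tree :: linorder
begin
definition "(s::tree) \<le> t \<longleftrightarrow> tree_le s t"
definition "(s::tree) < t \<longleftrightarrow> tree_le s t \<and> s \<noteq> t"
instance
proof
  fix s t u :: tree
  show "s < t \<longleftrightarrow> s \<le> t \<and> \<not> t \<le> s"
    using tree_le_antisym by (auto simp: less_eq_tree_def less_tree_def tree_le_refl)
  show "s \<le> t \<Longrightarrow> t \<le> u \<Longrightarrow> s \<le> u" "s \<le> t \<Longrightarrow> t \<le> s \<Longrightarrow> s = t" "s \<le> s" "s \<le> t \<or> t \<le> s"
    unfolding less_eq_tree_def
    by (fact tree_le_trans tree_le_antisym tree_le_refl tree_le_total)+
qed
end

lemma Node_le_simps [simp]:
  "Node [] \<le> t"
  "\<not> Node (x # xs) \<le> Node []"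
  "Node (x # xs) \<le> Node (y # ys) \<longleftrightarrow> x < y \<or> x = y \<and> Node xs \<le> Node ys"
  by (auto simp: less_eq_tree_def less_tree_def)

lemma Node_less_simps [simp]:
  "\<not> Node xs < Node []"
  "Node [] < Node (y # ys)"
  "Node (x # xs) < Node (y # ys) \<longleftrightarrow> x < y \<or> x = y \<and> Node xs < Node ys"
  by (cases xs) (auto simp: less_le)

section \<open>Lexicographically maximal subsequences in a linear order\<close>

abbreviation descending :: "'a::linorder list \<Rightarrow> bool" where
  "descending \<equiv> sorted_wrt (\<ge>)"

text \<open>An entry that precedes a larger one is better skipped and any other entry is worth
  keeping, so this finds a lexicographically maximal subsequence without a choice; see
  \<open>subseq_le_lexmax\<close>.\<close>

fun lexmax :: "'a::linorder list \<Rightarrow> 'a list" where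
  "lexmax [] = []"
| "lexmax (x # xs) = (if \<forall>y \<in> set xs. y \<le> x then x # lexmax xs else lexmax xs)"

lemma subseq_lexmax: "subseq (lexmax xs) xs"
  by (induction xs) auto

lemma set_lexmax: "set (lexmax xs) \<subseteq> set xs"
  by (induction xs) auto

lemma lexmax_eq_Nil [simp]: "lexmax xs = [] \<longleftrightarrow> xs = []"
  by (induction xs) auto

lemma descending_lexmax: "descending (lexmax xs)"
  by (induction xs) (auto dest: subsetD[OF set_lexmax])

lemma lexmax_descending: "descending xs \<Longrightarrow> lexmax xs = xs"
  by (induction xs) auto

text \<open>The values of \<open>diam\<close> are computed with this rule: a symbol appended to a
  word alters only the end of its list of pieces, and the new last piece erases the earlier pieces
  below it.\<close>

lemma lexmax_snoc: "lexmax (xs @ [y]) = filter (\<lambda>x. y \<le> x) (lexmax xs) @ [y]"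
proof (induction xs)
  case (Cons x xs)
  show ?case
  proof (cases "\<forall>z \<in> set xs. z \<le> x")
    case True
    have "\<not> y \<le> x \<Longrightarrow> filter (\<lambda>x. y \<le> x) (lexmax xs) = []"
      using True set_lexmax[of xs] by (meson filter_False order_trans subsetD)
    then show ?thesis using Cons True by (cases "y \<le> x") auto
  qed (use Cons in auto)
qed simp

lemma le_hd_lexmax: "x \<in> set xs \<Longrightarrow> x \<le> hd (lexmax xs)"
proof (induction xs arbitrary: x)
  case (Cons y ys)
  show ?case
  proof (cases "\<forall>z\<in>set ys. z \<le> y")
    case False
    then obtain z where "z \<in> set ys" "y < z" by auto
    then have "y \<le> hd (lexmax ys)" using Cons.IH[of z] by simp
    then show ?thesis using Cons False by auto
  qed (use Cons in auto)
qed simp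

lemma Node_tl_le: "descending (x # xs) \<Longrightarrow> Node xs \<le> Node (x # xs)"
  by (induction xs arbitrary: x) auto

text \<open>Skipping a maximal \<open>x\<close> gains nothing, since a descending list is not below
  its tail. Selecting an \<open>x\<close> that precedes a larger entry loses at once, since
  \<open>lexmax xs\<close> starts with something larger.\<close>

lemma subseq_le_lexmax: "subseq ys xs \<Longrightarrow> Node ys \<le> Node (lexmax xs)"
proof (induction xs arbitrary: ys)
  case (Cons x xs)
  show ?case
  proof (cases "subseq ys xs")
    case True
    then have "Node ys \<le> Node (lexmax xs)" by (rule Cons.IH)
    moreover have "\<forall>y\<in>set xs. y \<le> x \<Longrightarrow> Node (lexmax xs) \<le> Node (x # lexmax xs)"
      using descending_lexmax[of "x # xs"] by (intro Node_tl_le) simp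
    ultimately show ?thesis by (cases "\<forall>y\<in>set xs. y \<le> x") (auto dest: order_trans)
  next
    case False
    then obtain zs where zs: "ys = x # zs" "subseq zs xs"
      using Cons.prems by (cases ys) (auto split: if_splits)
    show ?thesis
    proof (cases "\<forall>y\<in>set xs. y \<le> x")
      case True then show ?thesis using zs Cons.IH by auto
    next
      case False
      then obtain y where y: "y \<in> set xs" "x < y" by auto
      then obtain u us where "lexmax xs = u # us" by (cases "lexmax xs") auto
      moreover have "x < u" using le_hd_lexmax[OF y(1)] y(2) calculation by simp
      ultimately show ?thesis using zs False by auto
    qed
  qed
qed (auto dest: list_emb_Nil2 list_emb_length)

text \<open>Nothing fits between \<open>ys\<close> and \<open>ys @ [b]\<close>: among the lists with
  entries \<ge> \<open>b\<close>, the latter is the immediate successor of the former.\<close>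

lemma Node_snoc_le:
  "\<forall>z \<in> set zs. b \<le> z \<Longrightarrow> Node ys < Node zs \<Longrightarrow> Node (ys @ [b]) \<le> Node zs"
proof (induction ys arbitrary: zs)
  case Nil then show ?case by (cases zs) auto
next
  case (Cons y ys) then show ?case by (cases zs) auto
qed

lemma Node_less_snoc: "Node ys < Node (ys @ z # zs)"
  by (induction ys) auto

text \<open>Here \<^term>\<open>s\<close> plays the role of the successor of the last entry of \<^term>\<open>us\<close>.\<close>

lemma prefix_iff_between:
  assumes "us \<noteq> []" "descending us" "descending xs" "last us < s"
    "\<And>x. x \<in> set us \<union> set xs \<Longrightarrow> last us < x \<Longrightarrow> s \<le> x"
  shows "Node us \<le> Node xs \<and> Node xs < Node (filter (\<lambda>x. s \<le> x) (butlast us) @ [s])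
    \<longleftrightarrow> prefix us xs"
  using assms
proof (induction us arbitrary: xs)
  case (Cons u us)
  show ?case
  proof (cases us)
    case Nil
    then show ?thesis using Cons.prems(4) Cons.prems(5)[of "hd xs"] by (cases xs) auto
  next
    case us: (Cons u2 us')
    show ?thesis
    proof (cases xs)
      case Nil then show ?thesis using us by simp
    next
      case xs: (Cons x xs')
      have IH: "Node us \<le> Node xs' \<and> Node xs' < Node (filter (\<lambda>x. s \<le> x) (butlast us) @ [s])
          \<longleftrightarrow> prefix us xs'"
        using us xs Cons.prems by (intro Cons.IH) auto
      show ?thesis
      \<comment> \<open>If \<open>u\<close> survives the filter, both bounds start with
        \<open>u\<close>, which forces \<open>x = u\<close>. Otherwise descent makes all entries
        equal to \<open>u\<close>, the upper bound shrinks to \<open>[s]\<close>, and no entry lies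
        strictly between \<open>u\<close> and \<open>s\<close>, so again
        \<open>x = u\<close>.\<close>
      proof (cases "s \<le> u")
        case True
        then show ?thesis using IH us xs by auto
      next
        case False
        have "last us \<le> u" using Cons.prems us by auto
        moreover have "\<not> last us < u" using Cons.prems(5)[of u] us False by auto
        ultimately have u: "u = last us" by (metis antisym not_less)
        have fe: "filter (\<lambda>x. s \<le> x) (butlast us) = []"
          using Cons.prems(2) False by (meson filter_False in_set_butlastD order_trans sorted_wrt.simps(2))
        have "u < x \<Longrightarrow> s \<le> x" using Cons.prems(5)[of x] u us xs by auto
        moreover have "u = x \<Longrightarrow> Node xs' < Node [s]"
          using Cons.prems(3) xs False by (cases xs') auto
        ultimately show ?thesis using IH fe us xs False by auto
      qed
    qed
  qed
qed simp

section \<open>The order on words\<close>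

fun join :: "nat \<Rightarrow> word list \<Rightarrow> word" where
  "join n [] = []"
| "join n [p] = p"
| "join n (p # q # ps) = p @ n # join n (q # ps)"

lemma split_ne_Nil [simp]: "split_at_sym n w \<noteq> []"
  by (induction w) (auto split: list.split)

lemma split_notin: "n \<notin> set w \<Longrightarrow> split_at_sym n w = [w]"
  by (induction w) auto

lemma split_append: "n \<notin> set p \<Longrightarrow> split_at_sym n (p @ n # w) = p # split_at_sym n w"
  by (induction p) auto

lemma split_join:
  "ps \<noteq> [] \<Longrightarrow> \<forall>p \<in> set ps. n \<notin> set p \<Longrightarrow> split_at_sym n (join n ps) = ps"
  by (induction n ps rule: join.induct) (auto simp: split_notin split_append)

lemma join_Cons: "ps \<noteq> [] \<Longrightarrow> join n (p # ps) = p @ n # join n ps"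
  by (cases ps) auto

lemma join_split [simp]: "join n (split_at_sym n w) = w"
proof (induction w)
  case (Cons x w)
  obtain p ps where "split_at_sym n w = p # ps" by (cases "split_at_sym n w") auto
  then show ?case using Cons by (cases ps) auto
qed simp

lemma set_split: "p \<in> set (split_at_sym n w) \<Longrightarrow> set p \<subseteq> set w - {n}"
proof (induction w arbitrary: p)
  case (Cons x w)
  obtain q ps where s: "split_at_sym n w = q # ps" by (cases "split_at_sym n w") auto
  show ?case
    using Cons.prems Cons.IH[of q] Cons.IH[of p] s by (auto split: if_splits)
qed simp

lemma set_join: "set (join n ps) \<subseteq> insert n (\<Union>p \<in> set ps. set p)"
  by (induction n ps rule: join.induct) auto

lemma split_snoc: "split_at_sym n (w @ [n]) = split_at_sym n w @ [[]]"
  by (induction w) (auto split: list.split)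

lemma split_snoc_other:
  "m \<noteq> n \<Longrightarrow> split_at_sym n (w @ [m]) =
    butlast (split_at_sym n w) @ [last (split_at_sym n w) @ [m]]"
proof (induction w)
  case (Cons x w)
  obtain q ps where s: "split_at_sym n w = q # ps" by (cases "split_at_sym n w") auto
  then show ?case using Cons by (cases ps) auto
qed simp

text \<open>\<^term>\<open>val d n w\<close> represents the class of a word \<^term>\<open>w\<close> with symbols in
  \<open>{n..<n + d}\<close> as the hereditary list of its lexicographically maximal subsequences.\<close>

primrec val :: "nat \<Rightarrow> nat \<Rightarrow> word \<Rightarrow> tree" where
  "val 0 n w = Node []"
| "val (Suc d) n w = Node (lexmax (map (val d (Suc n)) (split_at_sym n w)))"

lemma interval_remove_least:
  assumes "S \<subseteq> {n..<n + Suc d}" "n \<notin> S"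
  shows "S \<subseteq> {Suc n..<Suc n + d}"
proof
  fix x assume "x \<in> S"
  then have "x \<noteq> n" "x \<in> {n..<n + Suc d}" using assms by blast+
  then show "x \<in> {Suc n..<Suc n + d}" by simp
qed

lemma split_range:
  "set w \<subseteq> {n..<n + Suc d} \<Longrightarrow> p \<in> set (split_at_sym n w) \<Longrightarrow> set p \<subseteq> {Suc n..<Suc n + d}"
  using set_split[of p n w] by (intro interval_remove_least) auto

text \<open>Widening the window by an absent least symbol only wraps the value into a singleton,
  which respects the order. So \<open>val\<close> may treat one symbol at a time although
  \<open>wle\<close> jumps to the minimal symbol present.\<close>

lemma val_notin: "n \<notin> set w \<Longrightarrow> val (Suc d) n w = Node [val d (Suc n) w]"
  by (simp add: split_notin)

lemma val_Nil_le: "val d n [] \<le> val d n w"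
proof (induction d arbitrary: n w)
  case (Suc d)
  obtain x xs where "lexmax (map (val d (Suc n)) (split_at_sym n w)) = x # xs"
    by (cases "lexmax (map (val d (Suc n)) (split_at_sym n w))") auto
  moreover from this have "x \<in> val d (Suc n) ` set (split_at_sym n w)"
    using set_lexmax[of "map (val d (Suc n)) (split_at_sym n w)"] by auto
  ultimately have "val d (Suc n) [] \<le> x" using Suc[of "Suc n"] by auto
  then show ?case using \<open>_ = x # xs\<close> by (cases "val d (Suc n) [] = x") auto
qed simp

lemma lexle_simps:
  "lexle le [] ys"
  "\<not> lexle le (x # xs) []"
  "lexle le (x # xs) (y # ys) \<longleftrightarrow> pless le x y \<or> psim le x y \<and> lexle le xs ys"
  by (auto simp: lexle_def All_less_Suc2 Ex_less_Suc2)

lemma lexle_iff_Node_le: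
  fixes f :: "'a \<Rightarrow> tree"
  assumes "\<And>x y. x \<in> Q \<Longrightarrow> y \<in> Q \<Longrightarrow> le x y \<longleftrightarrow> f x \<le> f y" "set xs \<subseteq> Q" "set ys \<subseteq> Q"
  shows "lexle le xs ys \<longleftrightarrow> Node (map f xs) \<le> Node (map f ys)"
  using assms(2,3)
proof (induction xs arbitrary: ys)
  case (Cons x xs)
  show ?case
  proof (cases ys)
    case (Cons y ys')
    then have "psim le x y \<longleftrightarrow> f x = f y" "pless le x y \<longleftrightarrow> f x < f y"
      using Cons.prems assms(1) by (auto simp: psim_def pless_def)
    then show ?thesis using Cons Cons.prems Cons.IH[of ys'] by (simp add: lexle_simps)
  qed (simp add: lexle_simps)
qed (simp add: lexle_simps)

lemma subseq_map_obtain: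
  assumes "subseq zs (map f xs)" obtains ys where "subseq ys xs" "zs = map f ys"
proof -
  obtain N where "zs = nths (map f xs) N" using assms unfolding subseq_conv_nths by blast
  then show ?thesis using that[of "nths xs N"] by (auto simp: nths_map subseq_conv_nths)
qed

text \<open>A preorder can have several maximal subsequences, so the list picked by
  \<open>SOME\<close> is not determined. Its image under \<open>f\<close> is, because
  \<open>f\<close> carries the preorder to a linear order.\<close>

lemma some_lexmax_subseq:
  fixes f :: "'a \<Rightarrow> tree"
  assumes "\<And>x y. x \<in> Q \<Longrightarrow> y \<in> Q \<Longrightarrow> le x y \<longleftrightarrow> f x \<le> f y" "set xs \<subseteq> Q"
  defines "C \<equiv> SOME C. lexmax_subseq le xs C"
  shows "set C \<subseteq> Q" "map f C = lexmax (map f xs)"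
proof -
  have sub: "set D \<subseteq> Q" if "subseq D xs" for D
    using that assms(2) set_nths_subset unfolding subseq_conv_nths by fast
  have char: "lexmax_subseq le xs C \<longleftrightarrow> subseq C xs \<and> map f C = lexmax (map f xs)" for C
  proof
    assume C: "lexmax_subseq le xs C"
    obtain D where D: "subseq D xs" "lexmax (map f xs) = map f D"
      using subseq_map_obtain[OF subseq_lexmax] by metis
    have "subseq C xs" "\<not> pless (lexle le) C D" using C D unfolding lexmax_subseq_def by auto
    then have "Node (map f D) \<le> Node (map f C)"
      using sub D(1) unfolding pless_def
      by (auto simp: lexle_iff_Node_le[OF assms(1)])
    moreover have "Node (map f C) \<le> Node (map f D)"
      using subseq_le_lexmax[OF subseq_map[OF \<open>subseq C xs\<close>, of f]] D(2) by simp
    ultimately show "subseq C xs \<and> map f C = lexmax (map f xs)"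
      using D(2) \<open>subseq C xs\<close> by (metis antisym tree.inject)
  next
    assume C: "subseq C xs \<and> map f C = lexmax (map f xs)"
    have "lexle le D C" if "subseq D xs" for D
      using subseq_le_lexmax[OF subseq_map[OF that, of f]] C sub that
      by (simp add: lexle_iff_Node_le[OF assms(1)])
    then show "lexmax_subseq le xs C" using C unfolding lexmax_subseq_def pless_def by blast
  qed
  obtain D where "subseq D xs" "lexmax (map f xs) = map f D"
    using subseq_map_obtain[OF subseq_lexmax] by metis
  then have "lexmax_subseq le xs D" using char by simp
  then have "lexmax_subseq le xs C" unfolding C_def by (rule someI)
  then show "set C \<subseteq> Q" "map f C = lexmax (map f xs)" using char sub by auto
qed

text \<open>The fuel is any bound above the differences of symbols, since pieces are compared with
  leftover fuel that need not be their own \<open>wmeasure\<close>. The induction is on the width of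
  the window; fuel is spent only at symbols that occur.\<close>

lemma wle_aux_iff_val:
  assumes "set (A @ B) \<subseteq> {n..<n + d}" "\<And>x y. x \<in> set (A @ B) \<Longrightarrow> y \<in> set (A @ B) \<Longrightarrow> x - y < k"
  shows "wle_aux k A B \<longleftrightarrow> val d n A \<le> val d n B"
  using assms
proof (induction d arbitrary: n k A B)
  case 0 then show ?case by (cases k) auto
next
  case (Suc d)
  show ?case
  proof (cases "n \<in> set (A @ B)")
    case False
    have "set (A @ B) \<subseteq> {Suc n..<Suc n + d}"
      using Suc.prems(1) False by (rule interval_remove_least)
    then have "wle_aux k A B \<longleftrightarrow> val d (Suc n) A \<le> val d (Suc n) B"
      using Suc.prems(2) by (intro Suc.IH)
    then show ?thesis using False by (simp add: val_notin le_less del: val.simps)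
  next
    case True
    then have "k \<noteq> 0" using Suc.prems(2)[OF True True] by simp
    then obtain k' where k: "k = Suc k'" by (cases k) auto
    have min: "Min (set (A @ B)) = n"
      using True Suc.prems(1) by (intro Min_eqI) auto
    define Q where "Q = {w. set w \<subseteq> set (A @ B) - {n}}"
    have le: "wle_aux k' x y \<longleftrightarrow> val d (Suc n) x \<le> val d (Suc n) y" if "x \<in> Q" "y \<in> Q" for x y
    proof (rule Suc.IH)
      have xy: "set (x @ y) \<subseteq> set (A @ B) - {n}" using that by (auto simp: Q_def)
      then show "set (x @ y) \<subseteq> {Suc n..<Suc n + d}"
        using Suc.prems(1) by (intro interval_remove_least) auto
      then have "v \<in> set (x @ y) \<Longrightarrow> Suc n \<le> v" for v by auto
      note gt = this
      fix u v assume uv: "u \<in> set (x @ y)" "v \<in> set (x @ y)"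
      \<comment> \<open>The symbols of the pieces exceed \<open>n\<close>, so differences drop by at
        least one when measured from \<open>v\<close> instead of \<open>n\<close>; this pays for the
        unit of fuel.\<close>
      then have "u - n < Suc k'" using Suc.prems(2)[of u n] xy True k by blast
      moreover have "n < v" "n < u" using gt[OF uv(1)] gt[OF uv(2)] by auto
      ultimately show "u - v < k'" by linarith
    qed
    have Q: "set (split_at_sym n A) \<subseteq> Q" "set (split_at_sym n B) \<subseteq> Q"
      using set_split[of _ n A] set_split[of _ n B] by (auto simp: Q_def)
    let ?C = "SOME C. lexmax_subseq (wle_aux k') (split_at_sym n A) C"
    let ?D = "SOME C. lexmax_subseq (wle_aux k') (split_at_sym n B) C"
    have "wle_aux k A B \<longleftrightarrow> lexle (wle_aux k') ?C ?D"
      using True min by (auto simp: k Let_def)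
    also have "\<dots> \<longleftrightarrow> val (Suc d) n A \<le> val (Suc d) n B"
      using some_lexmax_subseq[of Q, OF le Q(1)] some_lexmax_subseq[of Q, OF le Q(2)]
      by (simp add: lexle_iff_Node_le[of Q, OF le])
    finally show ?thesis .
  qed
qed

lemma wle_iff_val:
  assumes "set A \<subseteq> {n..<n + d}" "set B \<subseteq> {n..<n + d}"
  shows "wle A B \<longleftrightarrow> val d n A \<le> val d n B"
  unfolding wle_def
proof (rule wle_aux_iff_val)
  fix x y assume "x \<in> set (A @ B)" "y \<in> set (A @ B)"
  then have "x \<le> Max (set (A @ B))" "Min (set (A @ B)) \<le> y" "A @ B \<noteq> []" by auto
  then show "x - y < wmeasure (A @ B)" unfolding wmeasure_def by auto
qed (use assms in auto)

section \<open>Existence and uniqueness of normal forms\<close>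

lemma NF_iff:
  assumes "\<forall>x \<in> set w. n \<le> x"
  shows "NF w \<longleftrightarrow> (\<forall>p \<in> set (split_at_sym n w). NF p) \<and>
    (\<forall>i. Suc i < length (split_at_sym n w) \<longrightarrow>
      wle (split_at_sym n w ! Suc i) (split_at_sym n w ! i))"
proof (cases "n \<in> set w")
  \<comment> \<open>Any lower bound \<open>n\<close> can replace the minimum in the definition of
    \<open>NF\<close>: if \<open>n\<close> is absent, the only piece is \<open>w\<close> itself and
    the ordering condition is vacuous.\<close>
  case False
  then show ?thesis by (simp add: split_notin)
next
  case True
  then have min: "Min (set w) = n" "w \<noteq> []" using assms by (auto intro: Min_eqI)
  obtain u v where "w = u @ n # v" "n \<notin> set u" using True by (metis split_list_first)
  then have "length (split_at_sym n w) \<ge> 2"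
    by (cases "split_at_sym n v") (auto simp: split_append)
  then show ?thesis using min by (subst NF.simps) auto
qed

lemma val_piece_le:
  assumes "set w \<subseteq> {n..<n + Suc d}" "x \<in> set (split_at_sym n w)" "y \<in> set (split_at_sym n w)"
  shows "wle x y \<longleftrightarrow> val d (Suc n) x \<le> val d (Suc n) y"
  using assms by (intro wle_iff_val split_range)

lemma NF_iff_val:
  assumes "set w \<subseteq> {n..<n + Suc d}"
  shows "NF w \<longleftrightarrow> (\<forall>p \<in> set (split_at_sym n w). NF p) \<and>
    descending (map (val d (Suc n)) (split_at_sym n w))"
proof -
  have "descending (map (val d (Suc n)) (split_at_sym n w)) \<longleftrightarrow>
    (\<forall>i. Suc i < length (split_at_sym n w) \<longrightarrow>
      wle (split_at_sym n w ! Suc i) (split_at_sym n w ! i))"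
    using val_piece_le[OF assms]
    by (subst sorted_wrt_iff_nth_Suc_transp) (auto simp: transp_def)
  moreover have "\<forall>x \<in> set w. n \<le> x" using assms by auto
  ultimately show ?thesis using NF_iff[of w n] by blast
qed

lemma val_NF:
  assumes "NF w" "set w \<subseteq> {n..<n + Suc d}"
  shows "val (Suc d) n w = Node (map (val d (Suc n)) (split_at_sym n w))"
  using assms NF_iff_val[OF assms(2)] by (simp add: lexmax_descending)

text \<open>No piece of a normal form is erased, so the value lists the values of all pieces, from
  which the pieces are recovered recursively.\<close>

lemma val_inj:
  assumes "NF A" "NF B" "set A \<subseteq> {n..<n + d}" "set B \<subseteq> {n..<n + d}" "val d n A = val d n B"
  shows "A = B"
  using assms
proof (induction d arbitrary: n A B)
  case (Suc d)
  have "map (val d (Suc n)) (split_at_sym n A) = map (val d (Suc n)) (split_at_sym n B)"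
    using Suc.prems by (simp add: val_NF del: val.simps)
  moreover have "inj_on (val d (Suc n)) (set (split_at_sym n A) \<union> set (split_at_sym n B))"
  proof (rule inj_onI)
    fix x y
    assume "x \<in> set (split_at_sym n A) \<union> set (split_at_sym n B)"
      "y \<in> set (split_at_sym n A) \<union> set (split_at_sym n B)"
      "val d (Suc n) x = val d (Suc n) y"
    moreover from this have "NF x" "NF y"
      using NF_iff_val[OF Suc.prems(3)] NF_iff_val[OF Suc.prems(4)] Suc.prems(1,2) by blast+
    moreover from calculation have
      "set x \<subseteq> {Suc n..<Suc n + d}" "set y \<subseteq> {Suc n..<Suc n + d}"
      using split_range[OF Suc.prems(3)] split_range[OF Suc.prems(4)] by blast+
    ultimately show "x = y" using Suc.IH by blast
  qed
  ultimately have "split_at_sym n A = split_at_sym n B" by (rule map_inj_on)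
  then show ?case by (metis join_split)
qed auto

lemma NF_join:
  assumes "ps \<noteq> []" "\<forall>p \<in> set ps. NF p \<and> set p \<subseteq> {Suc n..<Suc n + d}"
    "descending (map (val d (Suc n)) ps)"
  shows "NF (join n ps)" "set (join n ps) \<subseteq> {n..<n + Suc d}" "split_at_sym n (join n ps) = ps"
    "val (Suc d) n (join n ps) = Node (map (val d (Suc n)) ps)"
proof -
  show s: "split_at_sym n (join n ps) = ps" using assms by (intro split_join) fastforce+
  show r: "set (join n ps) \<subseteq> {n..<n + Suc d}"
    using set_join[of n ps] assms(2) by fastforce
  show "NF (join n ps)" using NF_iff_val[OF r] s assms by simp
  then show "val (Suc d) n (join n ps) = Node (map (val d (Suc n)) ps)"
    using val_NF[OF _ r] s by simp
qed

text \<open>Normalize the pieces, keep those of a maximal subsequence and glue them with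
  \<open>n\<close>. That no symbol is added is what later confines \<open>diam m A\<close> to the
  symbols of \<open>A\<close> and \<open>m\<close>.\<close>

lemma NF_exists:
  assumes "set A \<subseteq> {n..<n + d}"
  obtains B where "NF B" "set B \<subseteq> set A" "val d n B = val d n A"
  using assms
proof (induction d arbitrary: n A thesis)
  case 0
  then show ?case using NF_Nil by auto
next
  case (Suc d)
  let ?ps = "split_at_sym n A"
  have "\<exists>q. NF q \<and> set q \<subseteq> set p \<and> val d (Suc n) q = val d (Suc n) p" if "p \<in> set ?ps" for p
    using Suc.IH[OF _ split_range[OF Suc.prems(2) that]] by metis
  then obtain g where g: "\<And>p. p \<in> set ?ps \<Longrightarrow>
    NF (g p) \<and> set (g p) \<subseteq> set p \<and> val d (Suc n) (g p) = val d (Suc n) p" by metis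
  obtain ps where ps: "subseq ps ?ps"
    "lexmax (map (val d (Suc n)) ?ps) = map (val d (Suc n)) ps"
    using subseq_map_obtain[OF subseq_lexmax] by metis
  have sub: "set ps \<subseteq> set ?ps" using ps(1) set_nths_subset unfolding subseq_conv_nths by fast
  have vg: "map (val d (Suc n)) (map g ps) = map (val d (Suc n)) ps" using g sub by auto
  have ne: "ps \<noteq> []" using ps(2) by (metis lexmax_eq_Nil list.map_disc_iff split_ne_Nil)
  have pieces: "\<forall>q \<in> set (map g ps). NF q \<and> set q \<subseteq> {Suc n..<Suc n + d}"
    using g sub split_range[OF Suc.prems(2)] by fastforce
  have "descending (map (val d (Suc n)) (map g ps))"
    unfolding vg ps(2)[symmetric] by (rule descending_lexmax)
  note J = NF_join[OF _ pieces this]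
  have "set (join n (map g ps)) \<subseteq> set A"
  proof (cases "n \<in> set A")
    case True
    then show ?thesis using set_join[of n "map g ps"] g sub set_split[of _ n A] by fastforce
  next
    case False
    then have "ps = [A]"
      using ps(1) ne by (cases ps; cases "tl ps") (auto simp: split_notin split: if_splits)
    then show ?thesis using g False by (simp add: split_notin)
  qed
  moreover have "val (Suc d) n (join n (map g ps)) = val (Suc d) n A"
    using J(4) ne vg ps(2) by simp
  ultimately show ?case using Suc.prems(1) J(1) ne by blast
qed

section \<open>The operators \<open>diam\<close> and the order on normal forms\<close>

lemma obtain_bound: obtains d where "finite S \<Longrightarrow> S \<subseteq> {0::nat..<0 + d}" "m \<le> d"
proof (cases "finite S")
  case True
  then obtain k where "\<forall>x \<in> S. x < k" by (meson finite_nat_set_iff_bounded)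
  then show ?thesis by (intro that[of "k + m"]) force+
qed (auto intro: that)

lemma diam_NF:
  assumes "NF A"
  shows "NF (diam m A)" "set (diam m A) \<subseteq> insert m (set A)"
    "set A \<subseteq> {0..<0 + d} \<Longrightarrow> m < d \<Longrightarrow> val d 0 (diam m A) = val d 0 (A @ [m])"
proof -
  obtain d' where "set (A @ [m]) \<subseteq> {0..<0 + d'}" using obtain_bound finite_set by metis
  then obtain B where B: "NF B" "set B \<subseteq> set (A @ [m])" "val d' 0 B = val d' 0 (A @ [m])"
    using NF_exists by blast
  have sim: "wsim C (A @ [m]) \<longleftrightarrow> val e 0 C = val e 0 (A @ [m])"
    if "set C \<subseteq> {0..<0 + e}" "set (A @ [m]) \<subseteq> {0..<0 + e}" for C e
    unfolding wsim_def wle_iff_val[OF that] wle_iff_val[OF that(2,1)] by auto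
  have "wsim B (A @ [m])" using sim B \<open>set (A @ [m]) \<subseteq> _\<close> by blast
  moreover have "C = B" if "NF C" "wsim C (A @ [m])" for C
  proof -
    \<comment> \<open>Uniqueness is claimed among all words, so \<open>C\<close> may have symbols
      outside the window chosen for \<open>A\<close>; a common window is needed.\<close>
    obtain e where e: "set (A @ C @ [m]) \<subseteq> {0..<0 + e}" using obtain_bound finite_set by metis
    then have "val e 0 C = val e 0 (A @ [m])" using sim that by auto
    moreover have "val e 0 B = val e 0 (A @ [m])"
      using sim[of B e] \<open>wsim B (A @ [m])\<close> e B(2) by fastforce
    ultimately show ?thesis using that B e by (intro val_inj[of C B 0 e]) auto
  qed
  ultimately have dB: "diam m A = B" unfolding diam_def using B(1) by (blast intro: the_equality)
  show "NF (diam m A)" "set (diam m A) \<subseteq> insert m (set A)" using B dB by auto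
  show "val d 0 (diam m A) = val d 0 (A @ [m])" if "set A \<subseteq> {0..<0 + d}" "m < d"
  proof -
    have "set B \<subseteq> {0..<0 + d}" "set (A @ [m]) \<subseteq> {0..<0 + d}" using B(2) that by auto
    then show ?thesis using sim \<open>wsim B (A @ [m])\<close> dB by simp
  qed
qed

lemma diam_eqI:
  assumes "NF A" "NF B" "set A \<subseteq> {0..<0 + d}" "set B \<subseteq> {0..<0 + d}" "m < d"
    "val d 0 B = val d 0 (A @ [m])"
  shows "diam m A = B"
  using assms diam_NF(1,2)[OF assms(1), of m] diam_NF(3)[OF assms(1,3,5)]
  by (intro val_inj[of _ _ 0 d]) auto

lemma wless_iff_val:
  "set A \<subseteq> {n..<n + d} \<Longrightarrow> set B \<subseteq> {n..<n + d} \<Longrightarrow> wless A B \<longleftrightarrow> val d n A < val d n B"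
  unfolding wless_def by (auto simp: wle_iff_val)

lemma wless_linear:
  "\<not> wless A A"
  "wless A B \<Longrightarrow> wless B C \<Longrightarrow> wless A C"
  "NF A \<Longrightarrow> NF B \<Longrightarrow> A \<noteq> B \<Longrightarrow> wless A B \<or> wless B A"
proof -
  obtain d where "set (A @ B @ C) \<subseteq> {0..<0 + d}" using obtain_bound finite_set by metis
  then have d: "set A \<subseteq> {0..<0 + d}" "set B \<subseteq> {0..<0 + d}" "set C \<subseteq> {0..<0 + d}" by auto
  show "\<not> wless A A" by (simp add: wless_def)
  show "wless A B \<Longrightarrow> wless B C \<Longrightarrow> wless A C" 
    using wless_iff_val[OF d(1,2)] wless_iff_val[OF d(2,3)] wless_iff_val[OF d(1,3)] by auto
  show "NF A \<Longrightarrow> NF B \<Longrightarrow> A \<noteq> B \<Longrightarrow> wless A B \<or> wless B A"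
    using wless_iff_val[OF d(1,2)] wless_iff_val[OF d(2,1)] val_inj[OF _ _ d(1,2)]
    by (auto simp: neq_iff)
qed

text \<open>Appending 1 to \<open>p\<close> gives its last piece one more component, the empty one,
  which is least. The last piece thus moves to its immediate successor among words over symbols
  \<ge> 1, and \<open>prefix_iff_between\<close> applies.\<close>

lemma between_diam1_iff:
  assumes "NF x" "NF p"
  shows "\<not> wless x p \<and> wless x (diam 1 p) \<longleftrightarrow> prefix (split_at_sym 0 p) (split_at_sym 0 x)"
proof -
  obtain d0 where "set (x @ p) \<subseteq> {0..<0 + d0}" "2 \<le> d0" using obtain_bound finite_set by metis
  then obtain d where d: "set x \<subseteq> {0..<0 + Suc (Suc d)}" "set p \<subseteq> {0..<0 + Suc (Suc d)}"
    by (metis One_nat_def Suc_1 Suc_le_D add_0 add_leD2 set_append sup.bounded_iff Suc_le_mono)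
  define ps where "ps = split_at_sym 0 p"
  define f where "f = val (Suc d) 1"
  define s where "s = f (last ps @ [1])"
  have nfx: "\<forall>q \<in> set (split_at_sym 0 x). NF q" "descending (map f (split_at_sym 0 x))"
    and nfp: "\<forall>q \<in> set ps. NF q" "descending (map f ps)"
    using NF_iff_val[OF d(1)] NF_iff_val[OF d(2)] assms by (simp_all add: f_def ps_def)
  have rg: "set q \<subseteq> {1..<1 + Suc d}" if "q \<in> set ps \<union> set (split_at_sym 0 x)" for q
    using that split_range[OF d(1), of q] split_range[OF d(2), of q] by (auto simp: ps_def)
  have vx: "val (Suc (Suc d)) 0 x = Node (map f (split_at_sym 0 x))"
    and vp: "val (Suc (Suc d)) 0 p = Node (map f ps)"
    using val_NF[OF assms(1) d(1)] val_NF[OF assms(2) d(2)] by (simp_all add: f_def ps_def)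
  have ne: "ps \<noteq> []" "last ps \<in> set ps" by (simp_all add: ps_def)
  define b where "b = val d 2 []"
  define ys where "ys = map (val d 2) (split_at_sym 1 (last ps))"
  have b: "b \<le> val d 2 w" for w unfolding b_def by (rule val_Nil_le)
  have flast: "f (last ps) = Node ys"
    using val_NF[of "last ps" 1 d] rg[of "last ps"] nfp(1) ne
    by (simp add: f_def ys_def numeral_2_eq_2 del: val.simps)
  have "descending ys"
    using NF_iff_val[of "last ps" 1 d] rg[of "last ps"] nfp(1) ne
    by (simp add: ys_def numeral_2_eq_2 del: val.simps)
  moreover have "\<forall>y \<in> set ys. b \<le> y" using b by (auto simp: ys_def)
  ultimately have "lexmax (ys @ [b]) = ys @ [b]"
    by (simp add: lexmax_snoc lexmax_descending filter_id_conv)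
  moreover have "map (val d (Suc 1)) (split_at_sym 1 (last ps @ [1])) = ys @ [b]"
    by (simp only: split_snoc ys_def b_def Suc_1 map_append list.map)
  ultimately have s: "s = Node (ys @ [b])"
    by (simp only: s_def f_def val.simps)
  have "val (Suc (Suc d)) 0 (p @ [1]) = Node (filter (\<lambda>x. s \<le> x) (butlast (map f ps)) @ [s])"
  proof -
    have "split_at_sym 0 (p @ [1]) = butlast ps @ [last ps @ [1]]"
      by (simp add: split_snoc_other ps_def)
    moreover have "descending (map f (butlast ps))"
      using nfp(2) ne(1) by (metis append_butlast_last_id map_append sorted_wrt_append)
    ultimately show ?thesis
      by (simp add: lexmax_snoc lexmax_descending s_def f_def map_butlast del: val.simps(2)
        add: val.simps(2)[of "Suc d" 0])
  qed
  moreover have "val (Suc (Suc d)) 0 (diam 1 p) = val (Suc (Suc d)) 0 (p @ [1])"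
    using diam_NF(3)[OF assms(2) d(2), of 1] by (simp del: val.simps)
  moreover have dset: "set (diam 1 p) \<subseteq> {0..<0 + Suc (Suc d)}"
    using diam_NF(2)[OF assms(2), of 1] d(2) by auto
  ultimately have "\<not> wless x p \<and> wless x (diam 1 p) \<longleftrightarrow>
    Node (map f ps) \<le> Node (map f (split_at_sym 0 x)) \<and>
    Node (map f (split_at_sym 0 x)) < Node (filter (\<lambda>x. s \<le> x) (butlast (map f ps)) @ [s])"
    using wless_iff_val[OF d] wless_iff_val[OF d(1) dset] vx vp
    by (simp add: not_less del: val.simps)
  also have "\<dots> \<longleftrightarrow> prefix (map f ps) (map f (split_at_sym 0 x))"
  proof (rule prefix_iff_between)
    have last: "last (map f ps) = Node ys" using flast ne by (simp add: last_map)
    show "last (map f ps) < s" unfolding last s by (rule Node_less_snoc)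
    fix z assume "z \<in> set (map f ps) \<union> set (map f (split_at_sym 0 x))" "last (map f ps) < z"
    then obtain q where q: "z = f q" "Node ys < f q" using last by auto
    have "f q = Node (lexmax (map (val d 2) (split_at_sym 1 q)))"
      by (simp add: f_def numeral_2_eq_2)
    moreover have "\<forall>z \<in> set (lexmax (map (val d 2) (split_at_sym 1 q))). b \<le> z"
      using set_lexmax b by fastforce
    ultimately show "s \<le> z" using q s by (simp add: Node_snoc_le)
  qed (use ne nfx nfp in auto)
  also have "\<dots> \<longleftrightarrow> prefix ps (split_at_sym 0 x)"
  proof
    assume "prefix (map f ps) (map f (split_at_sym 0 x))"
    then have eq: "map f ps = map f (take (length ps) (split_at_sym 0 x))"
      by (metis length_map prefix_def take_map append_eq_conv_conj)
    have "inj_on f (set ps \<union> set (take (length ps) (split_at_sym 0 x)))"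
    proof (rule inj_onI)
      fix q r
      assume "q \<in> set ps \<union> set (take (length ps) (split_at_sym 0 x))"
        "r \<in> set ps \<union> set (take (length ps) (split_at_sym 0 x))" "f q = f r"
      then show "q = r" using rg nfx(1) nfp(1)
        by (intro val_inj[of q r 1 "Suc d"]) (auto simp: f_def dest!: in_set_takeD)
    qed
    with eq have "ps = take (length ps) (split_at_sym 0 x)" by (metis map_inj_on)
    then show "prefix ps (split_at_sym 0 x)" by (metis take_is_prefix)
  qed (rule map_mono_prefix)
  finally show ?thesis by (simp add: ps_def)
qed

section \<open>Arithmetic on labels\<close>

definition fm_interval :: "nat \<Rightarrow> nat \<Rightarrow> fm" where
  "fm_interval p x = Conj (Neg (Lt (Var x) (Var p))) (Lt (Var x) (F1 (Var p)))"

text \<open>Bound variables get indices above the sum of the free ones, which excludes capture for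
  all arguments.\<close>

definition fm_number :: "nat \<Rightarrow> nat \<Rightarrow> fm" where
  "fm_number w l = (let p = Suc (w + l) in Ex p (Conj (fm_interval p w) (Eq (Var l) (F3 (Var p)))))"

definition fm_rel :: "nat \<Rightarrow> nat \<Rightarrow> nat \<Rightarrow> fm" where
  "fm_rel x i r = (let p = Suc (x + i + r); q = Suc p; s = Suc q in
     Ex p (Conj (fm_interval p x) (Ex q (Conj (fm_interval q x) (Conj
       (Conj (Lt (Var p) (Var q))
         (Neg (Ex s (Conj (fm_interval s x) (Conj (Lt (Var p) (Var s)) (Lt (Var s) (Var q)))))))
       (Conj (Eq (Var i) (F3 (Var p))) (Eq (Var r) (F3 (Var q)))))))))"

definition fm_zero :: "nat \<Rightarrow> nat \<Rightarrow> fm" where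
  "fm_zero w l = (let m = Suc (w + l) in
     Conj (fm_number w l) (Neg (Ex m (Conj (fm_number w m) (Lt (Var m) (Var l))))))"

definition fm_suc :: "nat \<Rightarrow> nat \<Rightarrow> nat \<Rightarrow> fm" where
  "fm_suc w i j = (let m = Suc (w + i + j) in
     Conj (Conj (fm_number w i) (fm_number w j)) (Conj (Lt (Var i) (Var j))
       (Neg (Ex m (Conj (fm_number w m) (Conj (Lt (Var i) (Var m)) (Lt (Var m) (Var j))))))))"

definition fm_all :: "nat \<Rightarrow> fm \<Rightarrow> fm" where "fm_all i f = Neg (Ex i (Neg f))"
definition fm_imp :: "fm \<Rightarrow> fm \<Rightarrow> fm" where "fm_imp f g = Neg (Conj f (Neg g))"
definition fm_disj :: "fm \<Rightarrow> fm \<Rightarrow> fm" where "fm_disj f g = Neg (Conj (Neg f) (Neg g))"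
text \<open>The fold ends in a true sentence, which adds no free variable.\<close>

definition fm_conjs :: "fm list \<Rightarrow> fm" where "fm_conjs fs = foldr Conj fs (Neg (Ex 0 (Neg (Eq (Var 0) (Var 0)))))"
definition fm_exs :: "nat list \<Rightarrow> fm \<Rightarrow> fm" where "fm_exs is f = foldr Ex is f"

lemma freevars_fm [simp]:
  "freevars (fm_interval p x) = {p, x}"
  "freevars (fm_number w l) = {w, l}"
  "freevars (fm_rel x i r) = {x, i, r}"
  "freevars (fm_zero w l) = {w, l}"
  "freevars (fm_suc w i j) = {w, i, j}"
  "freevars (fm_all i f) = freevars f - {i}"
  "freevars (fm_imp f g) = freevars f \<union> freevars g"
  "freevars (fm_disj f g) = freevars f \<union> freevars g"
  "freevars (fm_conjs fs) = (\<Union>f \<in> set fs. freevars f)"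
  "freevars (fm_exs is f) = freevars f - set is"
proof -
  show "freevars (fm_conjs fs) = (\<Union>f \<in> set fs. freevars f)"
    by (induction fs) (auto simp: fm_conjs_def)
  show "freevars (fm_exs is f) = freevars f - set is"
    by (induction "is") (auto simp: fm_exs_def)
qed (auto simp: fm_interval_def fm_number_def fm_rel_def fm_zero_def fm_suc_def fm_all_def fm_imp_def
    fm_disj_def Let_def)

section \<open>Numbers, ranks and coded relations in a structure\<close>

locale coding_structure =
  fixes M :: "'a set" and lt :: "'a \<Rightarrow> 'a \<Rightarrow> bool" and g1 g3 :: "'a \<Rightarrow> 'a"
begin

abbreviation "holds \<equiv> sat M lt g1 g3"

definition "interval x = {p \<in> M. \<not> lt x p \<and> lt x (g1 p)}"
definition "numbers w = g3 ` interval w"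
definition "rel x i r \<longleftrightarrow> (\<exists>p \<in> interval x. \<exists>q \<in> interval x. lt p q \<and>
  \<not> (\<exists>s \<in> interval x. lt p s \<and> lt s q) \<and> i = g3 p \<and> r = g3 q)"
definition "rank w l = card {m \<in> numbers w. lt m l}"
definition "rep w n l \<longleftrightarrow> l \<in> numbers w \<and> rank w l = n"
text \<open>Richness that lets a single element store any finite table. The formulas never state it;
  it supplies the witnesses for completeness.\<close>

definition "frame N w \<longleftrightarrow> w \<in> M \<and> card (numbers w) = N \<and>
  (\<forall>P \<subseteq> numbers w \<times> numbers w. \<exists>x \<in> M. \<forall>i \<in> numbers w. \<forall>r \<in> numbers w.
    rel x i r \<longleftrightarrow> (i, r) \<in> P)"

lemma holds_interval: "v p \<in> M \<Longrightarrow> holds v (fm_interval p x) \<longleftrightarrow> v p \<in> interval (v x)"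
  by (auto simp: fm_interval_def interval_def)

lemma interval_subset: "interval x \<subseteq> M"
  by (auto simp: interval_def)

lemma holds_number: "holds v (fm_number w l) \<longleftrightarrow> v l \<in> numbers (v w)"
  using interval_subset
  by (fastforce simp: fm_number_def numbers_def holds_interval Let_def)

lemma holds_rel: "holds v (fm_rel x i r) \<longleftrightarrow> rel (v x) (v i) (v r)"
  using interval_subset
  by (simp add: fm_rel_def rel_def holds_interval Let_def) (meson subsetD)

lemma holds_logic [simp]:
  "holds v (fm_all i f) \<longleftrightarrow> (\<forall>a \<in> M. holds (v(i := a)) f)"
  "holds v (fm_imp f g) \<longleftrightarrow> (holds v f \<longrightarrow> holds v g)"
  "holds v (fm_disj f g) \<longleftrightarrow> (holds v f \<or> holds v g)"
  "holds v (fm_conjs fs) \<longleftrightarrow> (\<forall>f \<in> set fs. holds v f)"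
proof -
  show "holds v (fm_conjs fs) \<longleftrightarrow> (\<forall>f \<in> set fs. holds v f)"
    by (induction fs) (auto simp: fm_conjs_def)
qed (auto simp: fm_all_def fm_imp_def fm_disj_def)

lemma holds_exs:
  "holds v (fm_exs is f) \<longleftrightarrow>
    (\<exists>v'. (\<forall>i. i \<notin> set is \<longrightarrow> v' i = v i) \<and> (\<forall>i \<in> set is. v' i \<in> M) \<and> holds v' f)"
proof (induction "is" arbitrary: v)
  case Nil
  have "(\<forall>i. v' i = v i) \<longleftrightarrow> v' = v" for v' by auto
  then show ?case by (simp add: fm_exs_def)
next
  case (Cons i "is")
  have "holds v (fm_exs (i # is) f) \<longleftrightarrow> (\<exists>a \<in> M. holds (v(i := a)) (fm_exs is f))"
    by (simp add: fm_exs_def)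
  also have "\<dots> \<longleftrightarrow> (\<exists>v'. (\<forall>j. j \<notin> set (i # is) \<longrightarrow> v' j = v j) \<and> (\<forall>j \<in> set (i # is). v' j \<in> M) \<and>
    holds v' f)" (is "?l \<longleftrightarrow> ?r")
  proof
    assume ?l
    then obtain a v' where a: "a \<in> M" "\<forall>j. j \<notin> set is \<longrightarrow> v' j = (v(i := a)) j"
      "\<forall>j \<in> set is. v' j \<in> M" "holds v' f" using Cons by auto
    moreover have "v' i \<in> M" using a by (cases "i \<in> set is") auto
    ultimately show ?r by (intro exI[of _ v']) auto
  next
    assume ?r
    then obtain v' where "\<forall>j. j \<notin> set (i # is) \<longrightarrow> v' j = v j" "\<forall>j \<in> set (i # is). v' j \<in> M"
      "holds v' f" by blast
    then show ?l unfolding Cons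
      by (intro bexI[of _ "v' i"] exI[of _ v']) auto
  qed
  finally show ?case .
qed

end

locale coding_frames = coding_structure +
  assumes irrefl: "\<not> lt a a"
    and trans: "lt a b \<Longrightarrow> lt b c \<Longrightarrow> lt a c"
    and total: "a \<in> M \<Longrightarrow> b \<in> M \<Longrightarrow> a \<noteq> b \<Longrightarrow> lt a b \<or> lt b a"
    and g3_closed: "a \<in> M \<Longrightarrow> g3 a \<in> M"
    and finite_interval: "x \<in> M \<Longrightarrow> finite (interval x)"
    and frames: "\<exists>N > n. \<exists>w. frame N w"
begin

lemma numbers_subset: "numbers w \<subseteq> M"
  using g3_closed interval_subset by (auto simp: numbers_def)

lemma finite_numbers: "w \<in> M \<Longrightarrow> finite (numbers w)"
  by (simp add: numbers_def finite_interval)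

lemma rank_less_iff:
  assumes "w \<in> M" "i \<in> numbers w" "j \<in> numbers w"
  shows "lt i j \<longleftrightarrow> rank w i < rank w j"
proof -
  have less: "rank w i < rank w j" if "lt i j" "i \<in> numbers w" for i j
    unfolding rank_def
  proof (rule psubset_card_mono)
    show "{m \<in> numbers w. lt m i} \<subset> {m \<in> numbers w. lt m j}"
      using that irrefl trans by blast
  qed (use finite_numbers[OF assms(1)] in simp)
  show ?thesis
  proof
    assume "rank w i < rank w j"
    then have "i \<noteq> j" "\<not> lt j i" using less[of j i] assms by auto
    then show "lt i j" using total numbers_subset assms by blast
  qed (use less assms in blast)
qed

lemma inj_on_rank: "w \<in> M \<Longrightarrow> inj_on (rank w) (numbers w)"
  by (rule inj_onI) (metis less_irrefl numbers_subset rank_less_iff subsetD total)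

lemma rank_bound: "w \<in> M \<Longrightarrow> l \<in> numbers w \<Longrightarrow> rank w l < card (numbers w)"
  unfolding rank_def using irrefl finite_numbers by (intro psubset_card_mono) blast+

lemma rank_image: "w \<in> M \<Longrightarrow> rank w ` numbers w = {..<card (numbers w)}"
  using rank_bound by (intro card_subset_eq) (auto simp: card_image[OF inj_on_rank])

lemma rep_exists: "w \<in> M \<Longrightarrow> n < card (numbers w) \<Longrightarrow> \<exists>l. rep w n l"
  using rank_image[of w] unfolding rep_def by (metis imageE lessThan_iff)

lemma rep_unique: "w \<in> M \<Longrightarrow> rep w n l \<Longrightarrow> rep w n l' \<Longrightarrow> l = l'"
  using inj_on_rank[of w] unfolding rep_def by (auto dest: inj_onD)

lemma rep_in: "rep w n l \<Longrightarrow> l \<in> M"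
  using numbers_subset by (auto simp: rep_def)

lemma rep_fun: "rep w n l \<Longrightarrow> rep w m l \<Longrightarrow> n = m"
  by (auto simp: rep_def)

lemma holds_zero: "v w \<in> M \<Longrightarrow> holds v (fm_zero w l) \<longleftrightarrow> rep (v w) 0 (v l)"
proof -
  assume w: "v w \<in> M"
  have "holds v (fm_zero w l) \<longleftrightarrow> v l \<in> numbers (v w) \<and> {m \<in> numbers (v w). lt m (v l)} = {}"
    using numbers_subset by (auto simp: fm_zero_def holds_number Let_def)
  also have "\<dots> \<longleftrightarrow> rep (v w) 0 (v l)" using finite_numbers[OF w] by (auto simp: rep_def rank_def)
  finally show ?thesis .
qed

lemma holds_suc:
  assumes w: "v w \<in> M"
  shows "holds v (fm_suc w i j) \<longleftrightarrow>
    (\<exists>n. rep (v w) n (v i) \<and> rep (v w) (Suc n) (v j))"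
proof -
  let ?F = "numbers (v w)" and ?r = "rank (v w)"
  have "holds v (fm_suc w i j) \<longleftrightarrow>
      v i \<in> ?F \<and> v j \<in> ?F \<and> lt (v i) (v j) \<and> \<not> (\<exists>m \<in> ?F. lt (v i) m \<and> lt m (v j))"
    using numbers_subset by (auto simp: fm_suc_def holds_number Let_def)
  also have "\<dots> \<longleftrightarrow> v i \<in> ?F \<and> v j \<in> ?F \<and> ?r (v i) < ?r (v j) \<and>
      \<not> (\<exists>n \<in> ?r ` ?F. ?r (v i) < n \<and> n < ?r (v j))"
    using rank_less_iff[OF w] by auto
  \<comment> \<open>The ranks fill an initial segment of the naturals, so two ranks that are not
    consecutive have the rank of some label between them.\<close>
  also have "\<dots> \<longleftrightarrow> v i \<in> ?F \<and> v j \<in> ?F \<and> ?r (v j) = Suc (?r (v i))"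
  proof -
    have "?r (v j) < card ?F" if "v j \<in> ?F" using rank_bound[OF w that] .
    moreover have "b = Suc a \<longleftrightarrow> a < b \<and> \<not> (\<exists>n < c. a < n \<and> n < b)" if "b < c" for a b c :: nat
      using that by (metis Suc_lessI less_trans lessI not_less_eq)
    ultimately show ?thesis unfolding rank_image[OF w] by (metis lessThan_iff)
  qed
  finally show ?thesis by (auto simp: rep_def)
qed

end

section \<open>Representability of the recursive functions\<close>

context coding_frames
begin

text \<open>Variable \<open>2\<close> denotes the frame. Numbers are only available below the size of the frame, so
  completeness is claimed for sufficiently large frames only, whereas soundness holds in
  every frame.\<close>

definition represents :: "fm \<Rightarrow> nat list \<Rightarrow> nat \<Rightarrow> (nat list \<Rightarrow> nat) \<Rightarrow> bool" where
  "represents \<phi> xs y f \<longleftrightarrow> freevars \<phi> \<subseteq> insert 2 (insert y (set xs)) \<and>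
    (\<forall>v ns. range v \<subseteq> M \<longrightarrow> list_all2 (rep (v 2)) ns (map v xs) \<longrightarrow> holds v \<phi> \<longrightarrow>
      rep (v 2) (f ns) (v y)) \<and>
    (\<forall>ns. length ns = length xs \<longrightarrow> (\<exists>N0. \<forall>N \<ge> N0. \<forall>v. range v \<subseteq> M \<longrightarrow> frame N (v 2) \<longrightarrow>
      list_all2 (rep (v 2)) ns (map v xs) \<longrightarrow> rep (v 2) (f ns) (v y) \<longrightarrow> holds v \<phi>))"

lemma represents_soundD:
  "represents \<phi> xs y f \<Longrightarrow> range v \<subseteq> M \<Longrightarrow> list_all2 (rep (v 2)) ns (map v xs) \<Longrightarrow> holds v \<phi> \<Longrightarrow>
    rep (v 2) (f ns) (v y)"
  unfolding represents_def by blast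

lemma represents_completeD:
  assumes "represents \<phi> xs y f" "length ns = length xs"
  obtains N0 where "\<And>N v. N \<ge> N0 \<Longrightarrow> range v \<subseteq> M \<Longrightarrow> frame N (v 2) \<Longrightarrow>
      list_all2 (rep (v 2)) ns (map v xs) \<Longrightarrow> rep (v 2) (f ns) (v y) \<Longrightarrow> holds v \<phi>"
  using assms unfolding represents_def by metis

lemma frame_in: "frame N w \<Longrightarrow> w \<in> M"
  by (simp add: frame_def)

lemma frame_rep: "frame N w \<Longrightarrow> n < N \<Longrightarrow> \<exists>l. rep w n l"
  using rep_exists by (auto simp: frame_def)

lemma fresh_above:
  fixes S :: "nat set" assumes "finite S" obtains k where "\<And>i j. i \<in> S \<Longrightarrow> k \<le> j \<Longrightarrow> i \<noteq> j"
  using assms by (metis finite_nat_set_iff_bounded leD)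

lemma represents_zero: "represents (fm_zero 2 y) xs y (\<lambda>xs. 0)"
  unfolding represents_def using frame_in by (auto simp: holds_zero range_subsetD)

lemma represents_suc: "represents (fm_suc 2 x y) [x] y (\<lambda>xs. Suc (xs ! 0))"
  unfolding represents_def using frame_in
  by (auto simp: holds_suc range_subsetD list_all2_Cons2 length_Suc_conv dest: rep_fun) blast

lemma represents_proj:
  assumes "i < length xs"
  shows "represents (Eq (Var y) (Var (xs ! i))) xs y (\<lambda>xs. xs ! i)"
  unfolding represents_def
proof (intro conjI allI impI)
  fix v ns
  assume "range v \<subseteq> M" "list_all2 (rep (v 2)) ns (map v xs)" "holds v (Eq (Var y) (Var (xs ! i)))"
  then show "rep (v 2) (ns ! i) (v y)" using assms by (auto simp: list_all2_conv_all_nth)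
next
  fix ns :: "nat list" assume "length ns = length xs"
  show "\<exists>N0. \<forall>N \<ge> N0. \<forall>v. range v \<subseteq> M \<longrightarrow> frame N (v 2) \<longrightarrow>
      list_all2 (rep (v 2)) ns (map v xs) \<longrightarrow> rep (v 2) (ns ! i) (v y) \<longrightarrow>
      holds v (Eq (Var y) (Var (xs ! i)))"
    using assms
    by (intro exI[of _ 0]) (auto simp: list_all2_conv_all_nth intro: rep_unique[OF frame_in])
qed (use assms in auto)

lemma represents_comp:
  assumes f: "\<And>zs y. length zs = length gs \<Longrightarrow> \<exists>\<phi>. represents \<phi> zs y f"
    and g: "\<And>g y. g \<in> set gs \<Longrightarrow> \<exists>\<phi>. represents \<phi> xs y g"
  shows "\<exists>\<phi>. represents \<phi> xs y (\<lambda>xs. f (map (\<lambda>g. g xs) gs))"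
proof -
  let ?m = "length gs"
  obtain k where k: "\<And>i j. i \<in> insert 2 (insert y (set xs)) \<Longrightarrow> k \<le> j \<Longrightarrow> i \<noteq> j"
    using fresh_above[of "insert 2 (insert y (set xs))"] by auto
  define zs where "zs = [k..<k + ?m]"
  have disj: "i \<notin> set zs" if "i \<in> insert 2 (insert y (set xs))" for i
    using k[OF that] by (auto simp: zs_def)
  have zs: "length zs = ?m" "j < ?m \<Longrightarrow> zs ! j = k + j" for j by (auto simp: zs_def)
  obtain \<phi> where \<phi>: "represents \<phi> zs y f" using f[of zs y] zs by auto
  have "\<exists>\<gamma>. j < ?m \<longrightarrow> represents \<gamma> xs (k + j) (gs ! j)" for j
    using g nth_mem by blast
  then obtain \<gamma> where \<gamma>: "\<And>j. j < ?m \<Longrightarrow> represents (\<gamma> j) xs (k + j) (gs ! j)"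
    by metis
  let ?\<psi> = "fm_exs zs (Conj \<phi> (fm_conjs (map \<gamma> [0..<?m])))"
  have "represents ?\<psi> xs y (\<lambda>xs. f (map (\<lambda>g. g xs) gs))"
    unfolding represents_def
  proof (intro conjI allI impI)
    have "freevars (\<gamma> j) \<subseteq> insert 2 (insert y (set xs)) \<union> set zs" if "j < ?m" for j
      using \<gamma>[OF that] that by (auto simp: represents_def zs_def)
    then show "freevars ?\<psi> \<subseteq> insert 2 (insert y (set xs))"
      using \<phi> by (fastforce simp: represents_def)
  next
    fix v ns
    assume v: "range v \<subseteq> M" "list_all2 (rep (v 2)) ns (map v xs)" "holds v ?\<psi>"
    then obtain v' where v': "\<And>i. i \<notin> set zs \<Longrightarrow> v' i = v i" "\<And>i. i \<in> set zs \<Longrightarrow> v' i \<in> M"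
      "holds v' \<phi>" "\<And>j. j < ?m \<Longrightarrow> holds v' (\<gamma> j)"
      unfolding holds_exs by (force simp: atLeast0LessThan)
    have M: "range v' \<subseteq> M" using v(1) v'(1,2) by (metis image_subsetI rangeI subset_iff)
    have eq: "v' 2 = v 2" "v' y = v y" "map v' xs = map v xs" using v'(1) disj by auto
    have "list_all2 (rep (v' 2)) ns (map v' xs)" using v(2) by (simp only: eq)
    then have "rep (v' 2) ((gs ! j) ns) (v' (k + j))" if "j < ?m" for j
      using represents_soundD[OF \<gamma>[OF that] M _ v'(4)[OF that]] by blast
    then have "list_all2 (rep (v' 2)) (map (\<lambda>g. g ns) gs) (map v' zs)"
      by (auto simp: list_all2_conv_all_nth zs)
    from represents_soundD[OF \<phi> M this v'(3)]
    show "rep (v 2) (f (map (\<lambda>g. g ns) gs)) (v y)"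
      by (simp only: eq)
  next
    fix ns :: "nat list" assume ns: "length ns = length xs"
    let ?ms = "map (\<lambda>g. g ns) gs"
    obtain N0 where N0: "\<And>N v. N \<ge> N0 \<Longrightarrow> range v \<subseteq> M \<Longrightarrow> frame N (v 2) \<Longrightarrow>
      list_all2 (rep (v 2)) ?ms (map v zs) \<Longrightarrow> rep (v 2) (f ?ms) (v y) \<Longrightarrow> holds v \<phi>"
      using represents_completeD[OF \<phi>, of ?ms] zs by auto
    have "\<exists>n. \<forall>N v. N \<ge> n \<longrightarrow> range v \<subseteq> M \<longrightarrow> frame N (v 2) \<longrightarrow>
      list_all2 (rep (v 2)) ns (map v xs) \<longrightarrow> rep (v 2) ((gs ! j) ns) (v (k + j)) \<longrightarrow> holds v (\<gamma> j)"
      if "j < ?m" for j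
      using represents_completeD[OF \<gamma>[OF that] ns] by metis
    then obtain N1 where N1: "\<And>j N v. j < ?m \<Longrightarrow> N \<ge> N1 j \<Longrightarrow> range v \<subseteq> M \<Longrightarrow> frame N (v 2) \<Longrightarrow>
      list_all2 (rep (v 2)) ns (map v xs) \<Longrightarrow> rep (v 2) ((gs ! j) ns) (v (k + j)) \<Longrightarrow> holds v (\<gamma> j)"
      by metis
    \<comment> \<open>One threshold for all the formulas involved; the summand
      \<open>Suc ((gs ! j) ns)\<close> makes room in the frame for each intermediate value.\<close>
    define N2 where "N2 = N0 + (\<Sum>j<?m. N1 j + Suc ((gs ! j) ns))"
    have N2: "N1 j + Suc ((gs ! j) ns) \<le> N2" if "j < ?m" for j
      using that member_le_sum[of j "{..<?m}" "\<lambda>j. N1 j + Suc ((gs ! j) ns)"] by (simp add: N2_def)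
    have "holds v ?\<psi>" if "N \<ge> N2" "range v \<subseteq> M" "frame N (v 2)"
        "list_all2 (rep (v 2)) ns (map v xs)" "rep (v 2) (f ?ms) (v y)" for N v
    proof -
      have "\<exists>l. rep (v 2) ((gs ! j) ns) l" if "j < ?m" for j
        using frame_rep[OF \<open>frame N (v 2)\<close>] N2[OF that] \<open>N \<ge> N2\<close> by simp
      then obtain l where l: "\<And>j. j < ?m \<Longrightarrow> rep (v 2) ((gs ! j) ns) (l j)" by metis
      define v' where "v' i = (if i \<in> set zs then l (i - k) else v i)" for i
      have eq: "v' 2 = v 2" "v' y = v y" "map v' xs = map v xs" using disj by (auto simp: v'_def)
      have vz: "v' (k + j) = l j" if "j < ?m" for j using that by (auto simp: v'_def zs_def)
      have zM: "\<forall>i \<in> set zs. v' i \<in> M"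
        using rep_in[OF l] by (auto simp: v'_def zs_def)
      then have M: "range v' \<subseteq> M" using \<open>range v \<subseteq> M\<close> by (auto simp: v'_def)
      have "holds v' \<phi>"
        using N0[of N v'] that M eq l vz by (auto simp: N2_def list_all2_conv_all_nth zs)
      moreover have "holds v' (\<gamma> j)" if "j < ?m" for j
        using N1[OF that, of N v'] N2[OF that] \<open>N \<ge> N2\<close> M eq l[OF that] vz[OF that]
          \<open>frame N (v 2)\<close> \<open>list_all2 (rep (v 2)) ns (map v xs)\<close> by simp
      ultimately show ?thesis unfolding holds_exs
        using zM by (intro exI[of _ v']) (auto simp: v'_def)
    qed
    then show "\<exists>N0. \<forall>N \<ge> N0. \<forall>v. range v \<subseteq> M \<longrightarrow> frame N (v 2) \<longrightarrow>
      list_all2 (rep (v 2)) ns (map v xs) \<longrightarrow> rep (v 2) (f ?ms) (v y) \<longrightarrow> holds v ?\<psi>" by blast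
  qed
  then show ?thesis by blast
qed

text \<open>The formula asks for a relation in which every pair \<open>(i, z)\<close> is justified: either \<open>i = 0\<close> and
  \<open>z\<close> is the initial value, or \<open>z\<close> is computed from a pair \<open>(i - 1, z')\<close>. By induction on \<open>i\<close> such
  a relation contains only correct values.\<close>

lemma represents_prim:
  assumes f: "\<And>xs y. length xs = n \<Longrightarrow> \<exists>\<phi>. represents \<phi> xs y f"
    and g: "\<And>xs y. length xs = Suc (Suc n) \<Longrightarrow> \<exists>\<phi>. represents \<phi> xs y g"
    and "length xs = Suc n"
  shows "\<exists>\<phi>. represents \<phi> xs y
    (\<lambda>xs. rec_nat (f (tl xs)) (\<lambda>y r. g (y # r # tl xs)) (hd xs))"
proof -
  obtain x xt where xs: "xs = x # xt" "length xt = n" using assms(3) by (cases xs) auto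
  define r where "r ns = rec_nat (f ns) (\<lambda>y r. g (y # r # ns))" for ns
  have r0: "r ns 0 = f ns" and rS: "r ns (Suc m) = g (m # r ns m # ns)" for ns m
    by (simp_all add: r_def)
  obtain k where k: "\<And>i j. i \<in> insert 2 (insert y (set xs)) \<Longrightarrow> k \<le> j \<Longrightarrow> i \<noteq> j"
    using fresh_above[of "insert 2 (insert y (set xs))"] by auto
  define X i z i' z' where "X = k" "i = k + 1" "z = k + 2" "i' = k + 3" "z' = k + 4"
  note fresh = this
  have ne: "a \<notin> {X, i, z, i', z'}" if "a \<in> insert 2 (insert y (set xs))" for a
    using k[OF that] by (auto simp: fresh)
  obtain \<phi> where \<phi>: "represents \<phi> xt z f" using f xs by blast
  obtain \<gamma> where \<gamma>: "represents \<gamma> (i' # z' # xt) z g" using g[of "i' # z' # xt"] xs by auto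
  \<comment> \<open>The conjunct \<open>fm_number 2 z'\<close> subjects the justifying pair to the
    same requirement as the justified one, so that the induction can go on.\<close>
  let ?just = "fm_disj (Conj (fm_zero 2 i) \<phi>)
      (Ex i' (Ex z' (Conj (Conj (fm_number 2 z') (fm_suc 2 i' i)) (Conj (fm_rel X i' z') \<gamma>))))"
  let ?\<psi> = "Ex X (Conj (Conj (fm_number 2 y) (fm_rel X x y))
      (fm_all i (fm_all z (fm_imp (Conj (Conj (fm_number 2 i) (fm_number 2 z)) (fm_rel X i z))
        ?just))))"
  have "represents ?\<psi> xs y (\<lambda>xs. rec_nat (f (tl xs)) (\<lambda>y r. g (y # r # tl xs)) (hd xs))"
    unfolding represents_def r_def[symmetric]
  proof (intro conjI allI impI)
    show "freevars ?\<psi> \<subseteq> insert 2 (insert y (set xs))"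
      using \<phi> \<gamma> by (auto simp: represents_def xs)
  next
    fix v ns
    assume v: "range v \<subseteq> M" "list_all2 (rep (v 2)) ns (map v xs)" "holds v ?\<psi>"
    let ?w = "v 2"
    obtain n ms where ns: "ns = n # ms" "rep ?w n (v x)" "list_all2 (rep ?w) ms (map v xt)"
      using v(2) xs by (auto simp: list_all2_Cons2)
    have w: "?w \<in> M" using v(1) by auto
    obtain a where a: "a \<in> M" "v y \<in> numbers ?w" "rel a (v x) (v y)"
      and just: "\<And>b c. b \<in> M \<Longrightarrow> c \<in> M \<Longrightarrow> b \<in> numbers ?w \<Longrightarrow> c \<in> numbers ?w \<Longrightarrow> rel a b c \<Longrightarrow>
        holds (v(X := a, i := b, z := c)) ?just"
      using v(3) ne[of 2] ne[of y] ne[of x] xs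
      by (auto simp: holds_number holds_rel fresh)
    have map: "map (v(X := a, i := b, z := c)) xt = map v xt"
      "map (v(X := a, i := b, z := c, i' := d, z' := e)) xt = map v xt" for b c d e
      using ne xs by auto
    have "rep ?w (r ms m) c" if "rep ?w m b" "rel a b c" "c \<in> numbers ?w" for m b c
      using that
    proof (induction m arbitrary: b c)
      case 0
      let ?v = "v(X := a, i := b, z := c)"
      have bc: "b \<in> M" "c \<in> M" "b \<in> numbers ?w"
        using 0 rep_in numbers_subset by (auto simp: rep_def)
      have v': "?v 2 = ?w" "?v i = b" "?v z = c" using ne[of 2] by (auto simp: fresh)
      then have "holds ?v (Conj (fm_zero 2 i) \<phi>)"
        using just[OF bc(1,2) bc(3) 0(3) 0(2)] 0(1) w ne[of 2]
        by (auto simp: holds_suc fresh dest: rep_fun)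
      then have "holds ?v \<phi>" by simp
      moreover have "range ?v \<subseteq> M" using v(1) bc a(1) by auto
      moreover have "list_all2 (rep (?v 2)) ms (map ?v xt)" using ns(3) by (simp only: v' map)
      ultimately have "rep (?v 2) (f ms) (?v z)" using represents_soundD[OF \<phi>] by blast
      then show ?case by (simp only: v' r0)
    next
      case (Suc m)
      let ?v = "v(X := a, i := b, z := c)"
      have bc: "b \<in> M" "c \<in> M" "b \<in> numbers ?w"
        using Suc.prems rep_in numbers_subset by (auto simp: rep_def)
      have "?v 2 = ?w" "?v i = b" using ne[of 2] by (auto simp: fresh)
      then have "\<not> holds ?v (fm_zero 2 i)"
        using Suc.prems w by (auto simp: holds_zero dest: rep_fun)
      then obtain d e where de: "d \<in> M" "e \<in> M"
        "holds (?v(i' := d, z' := e)) (Conj (Conj (fm_number 2 z') (fm_suc 2 i' i)) (Conj (fm_rel X i' z') \<gamma>))"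
        using just[OF bc(1,2) bc(3) Suc.prems(3,2)] by auto
      let ?u = "?v(i' := d, z' := e)"
      have u: "?u 2 = ?w" "?u i = b" "?u z = c" "?u i' = d" "?u z' = e" "?u X = a"
        using ne[of 2] by (auto simp: fresh)
      have "e \<in> numbers ?w" "\<exists>n. rep ?w n d \<and> rep ?w (Suc n) b" "rel a d e"
        using de(3) w u by (simp_all add: holds_number holds_suc holds_rel del: fun_upd_apply)
      then have "rep ?w m d" using Suc.prems by (auto dest: rep_fun)
      moreover from this have "rep ?w (r ms m) e"
        using Suc.IH \<open>rel a d e\<close> \<open>e \<in> numbers ?w\<close> by blast
      ultimately have "list_all2 (rep (?u 2)) (m # r ms m # ms) (map ?u (i' # z' # xt))"
        using ns(3) by (simp only: list.map list_all2_Cons u map simp_thms)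
      moreover have "range ?u \<subseteq> M" using v(1) bc a(1) de(1,2) by auto
      moreover have "holds ?u \<gamma>" using de(3) by simp
      ultimately have "rep (?u 2) (g (m # r ms m # ms)) (?u z)"
        using represents_soundD[OF \<gamma>] by blast
      then show ?case by (simp only: u rS)
    qed
    then show "rep ?w (r (tl ns) (hd ns)) (v y)" using ns a by auto
  next
    fix ns :: "nat list" assume "length ns = length xs"
    then obtain n ms where ns: "ns = n # ms" "length ms = length xt" using xs by (cases ns) auto
    obtain N0 where N0: "\<And>N v. N \<ge> N0 \<Longrightarrow> range v \<subseteq> M \<Longrightarrow> frame N (v 2) \<Longrightarrow>
      list_all2 (rep (v 2)) ms (map v xt) \<Longrightarrow> rep (v 2) (f ms) (v z) \<Longrightarrow> holds v \<phi>"
      using represents_completeD[OF \<phi>, of ms] ns by auto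
    have "\<exists>N1. \<forall>N v. N \<ge> N1 \<longrightarrow> range v \<subseteq> M \<longrightarrow> frame N (v 2) \<longrightarrow>
      list_all2 (rep (v 2)) (m # r ms m # ms) (map v (i' # z' # xt)) \<longrightarrow>
      rep (v 2) (g (m # r ms m # ms)) (v z) \<longrightarrow> holds v \<gamma>" for m
      using represents_completeD[OF \<gamma>, of "m # r ms m # ms"] ns by (metis length_Cons)
    then obtain N1 where N1: "\<And>m N v. N \<ge> N1 m \<Longrightarrow> range v \<subseteq> M \<Longrightarrow> frame N (v 2) \<Longrightarrow>
      list_all2 (rep (v 2)) (m # r ms m # ms) (map v (i' # z' # xt)) \<Longrightarrow>
      rep (v 2) (g (m # r ms m # ms)) (v z) \<Longrightarrow> holds v \<gamma>" by metis
    define N2 where "N2 = N0 + (\<Sum>m\<le>n. N1 m + Suc (r ms m))"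
    have N2: "N1 m + Suc (r ms m) \<le> N2" if "m \<le> n" for m
      using that member_le_sum[of m "{..n}" "\<lambda>m. N1 m + Suc (r ms m)"] by (simp add: N2_def)
    have "holds v ?\<psi>" if v: "N \<ge> N2" "range v \<subseteq> M" "frame N (v 2)"
        "list_all2 (rep (v 2)) ns (map v xs)" "rep (v 2) (r (tl ns) (hd ns)) (v y)" for N v
    proof -
      let ?w = "v 2"
      have w: "?w \<in> M" using v(2) by auto
      have nx: "rep ?w n (v x)" "list_all2 (rep ?w) ms (map v xt)" "rep ?w (r ms n) (v y)"
        using v ns xs by auto
      \<comment> \<open>The graph of the recursion up to \<open>n\<close>: with each pair it
        contains the one that justifies it, and all its values fit into the frame.\<close>
      define P where "P = {(b, c). \<exists>m \<le> n. rep ?w m b \<and> rep ?w (r ms m) c}"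
      have "P \<subseteq> numbers ?w \<times> numbers ?w" by (auto simp: P_def rep_def)
      then obtain a where a: "a \<in> M"
        "\<And>b c. b \<in> numbers ?w \<Longrightarrow> c \<in> numbers ?w \<Longrightarrow> rel a b c \<longleftrightarrow> (b, c) \<in> P"
        using v(3) unfolding frame_def by metis
      have map: "map (v(X := a, i := b, z := c)) xt = map v xt"
        "map (v(X := a, i := b, z := c, i' := d, z' := e)) xt = map v xt" for b c d e
        using ne xs by auto
      have just: "holds (v(X := a, i := b, z := c)) ?just"
        if bc: "b \<in> M" "c \<in> M" "b \<in> numbers ?w" "c \<in> numbers ?w" "rel a b c" for b c
      proof -
        obtain m where m: "m \<le> n" "rep ?w m b" "rep ?w (r ms m) c"
          using a(2)[OF bc(3,4)] bc(5) by (auto simp: P_def)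
        let ?v = "v(X := a, i := b, z := c)"
        have v2: "?v 2 = ?w" "?v i = b" "?v z = c" using ne[of 2] by (auto simp: fresh)
        show ?thesis
        proof (cases m)
          case 0
          have "holds ?v (fm_zero 2 i)" using 0 m v2 w by (simp add: holds_zero del: fun_upd_apply)
          moreover have "holds ?v \<phi>"
          proof (rule N0[of N])
            show "N0 \<le> N" using v(1) by (simp add: N2_def)
            show "range ?v \<subseteq> M" using v(2) a(1) bc by auto
            show "frame N (?v 2)" "list_all2 (rep (?v 2)) ms (map ?v xt)" "rep (?v 2) (f ms) (?v z)"
              using v(3) nx m(3) by (simp_all only: v2 map r0 0)
          qed
          ultimately show ?thesis by simp
        next
          case (Suc m')
          have "r ms m' < N" "m' < N"
            using N2[of m'] v(1) m Suc rank_bound[OF w bc(3)] v(3) by (auto simp: rep_def frame_def)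
          then obtain d e where de: "rep ?w m' d" "rep ?w (r ms m') e"
            using frame_rep[OF v(3)] by metis
          let ?u = "?v(i' := d, z' := e)"
          have u: "?u 2 = ?w" "?u i = b" "?u z = c" "?u i' = d" "?u z' = e" "?u X = a"
            using ne[of 2] by (auto simp: fresh)
          have deM: "d \<in> M" "e \<in> M" "d \<in> numbers ?w" "e \<in> numbers ?w"
            using de rep_in by (auto simp: rep_def)
          have "rel a d e" using a(2)[OF deM(3,4)] de m Suc by (auto simp: P_def)
          moreover have "holds ?u \<gamma>"
          proof (rule N1[of m' N])
            show "N1 m' \<le> N" using N2[of m'] v(1) m Suc by simp
            show "range ?u \<subseteq> M" using v(2) a(1) bc deM by auto
            show "frame N (?u 2)" "list_all2 (rep (?u 2)) (m' # r ms m' # ms) (map ?u (i' # z' # xt))"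
              "rep (?u 2) (g (m' # r ms m' # ms)) (?u z)"
              using v(3) nx(2) m(3) de
              by (simp_all only: list.map list_all2_Cons u map rS Suc simp_thms)
          qed
          moreover have "holds ?u (fm_suc 2 i' i)"
            using w u de m Suc by (auto simp add: holds_suc simp del: fun_upd_apply)
          ultimately have "holds ?u (Conj (Conj (fm_number 2 z') (fm_suc 2 i' i)) (Conj (fm_rel X i' z') \<gamma>))"
            using u deM by (simp add: holds_number holds_rel del: fun_upd_apply)
          then show ?thesis using deM by auto
        qed
      qed
      have "rel a (v x) (v y)" using a(2) nx by (auto simp: P_def rep_def)
      moreover have "v y \<in> numbers ?w" using nx by (simp add: rep_def)
      ultimately have "holds (v(X := a)) (Conj (fm_number 2 y) (fm_rel X x y))"
        using ne[of 2] ne[of x] ne[of y] xs by (auto simp: holds_number holds_rel)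
      moreover have "holds (v(X := a)) (fm_all i (fm_all z
          (fm_imp (Conj (Conj (fm_number 2 i) (fm_number 2 z)) (fm_rel X i z)) ?just)))"
        using just ne[of 2] by (auto simp: holds_number holds_rel fresh simp del: holds_logic(3))
      ultimately show ?thesis using a(1) by auto
    qed
    then show "\<exists>N0. \<forall>N \<ge> N0. \<forall>v. range v \<subseteq> M \<longrightarrow> frame N (v 2) \<longrightarrow>
      list_all2 (rep (v 2)) ns (map v xs) \<longrightarrow> rep (v 2) (r (tl ns) (hd ns)) (v y) \<longrightarrow> holds v ?\<psi>"
      by blast
  qed
  then show ?thesis by blast
qed

text \<open>That a value is nonzero is asserted by a nonzero witness \<open>z\<close>, not by
  negating \<open>\<phi>\<close>, which may fail in a small \<open>w\<close> although the value is
  right.\<close>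

lemma represents_mu:
  assumes f: "\<And>xs y. length xs = Suc n \<Longrightarrow> \<exists>\<phi>. represents \<phi> xs y f"
    and tot: "\<And>ns. length ns = n \<Longrightarrow> \<exists>y. f (y # ns) = 0"
    and "length xs = n"
  shows "\<exists>\<phi>. represents \<phi> xs y (\<lambda>xs. LEAST y. f (y # xs) = 0)"
proof -
  obtain k where k: "\<And>i j. i \<in> insert 2 (insert y (set xs)) \<Longrightarrow> k \<le> j \<Longrightarrow> i \<noteq> j"
    using fresh_above[of "insert 2 (insert y (set xs))"] by auto
  define i z where "i = k" "z = k + 1"
  note fresh = this
  have ne: "a \<notin> {i, z}" if "a \<in> insert 2 (insert y (set xs))" for a
    using k[OF that] by (auto simp: fresh)
  have "i \<noteq> z" by (simp add: fresh)
  obtain \<phi> where \<phi>: "represents \<phi> (i # xs) z f" using f[of "i # xs"] assms(3) by auto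
  let ?\<psi> = "Conj (fm_number 2 y) (fm_all i (fm_imp (fm_number 2 i) (Conj
      (fm_imp (Eq (Var i) (Var y)) (Ex z (Conj (fm_zero 2 z) \<phi>)))
      (fm_imp (Lt (Var i) (Var y)) (Ex z (Conj (Neg (fm_zero 2 z)) \<phi>))))))"
  have sat: "holds v ?\<psi> \<longleftrightarrow> v y \<in> numbers (v 2) \<and> (\<forall>b \<in> numbers (v 2).
      (b = v y \<longrightarrow> (\<exists>c \<in> M. rep (v 2) 0 c \<and> holds (v(i := b, z := c)) \<phi>)) \<and>
      (lt b (v y) \<longrightarrow> (\<exists>c \<in> M. \<not> rep (v 2) 0 c \<and> holds (v(i := b, z := c)) \<phi>)))"
    if "range v \<subseteq> M" for v
    using numbers_subset[of "v 2"] that ne[of 2] ne[of y] \<open>i \<noteq> z\<close>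
    by (auto simp: holds_number holds_zero range_subsetD)
  have map: "map (v(i := b, z := c)) xs = map v xs" for v b c using ne by auto
  have "represents ?\<psi> xs y (\<lambda>xs. LEAST y. f (y # xs) = 0)"
    unfolding represents_def
  proof (intro conjI allI impI)
    show "freevars ?\<psi> \<subseteq> insert 2 (insert y (set xs))"
      using \<phi> by (auto simp: represents_def)
  next
    fix v ns
    assume v: "range v \<subseteq> M" "list_all2 (rep (v 2)) ns (map v xs)" "holds v ?\<psi>"
    let ?w = "v 2"
    have w: "?w \<in> M" using v(1) by auto
    note s = v(3)[unfolded sat[OF v(1)]]
    have sound: "rep ?w (f (m # ns)) c"
      if "rep ?w m b" "c \<in> M" "holds (v(i := b, z := c)) \<phi>" for m b c
    proof -
      let ?v = "v(i := b, z := c)"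
      have "?v 2 = ?w" "?v i = b" "?v z = c" using ne[of 2] \<open>i \<noteq> z\<close> by auto
      note v' = this
      have "range ?v \<subseteq> M" using v(1) that(2) rep_in[OF that(1)] by auto
      moreover have "list_all2 (rep (?v 2)) (m # ns) (map ?v (i # xs))"
        using that(1) v(2) by (simp only: list.map list_all2_Cons v' map simp_thms)
      ultimately show ?thesis using represents_soundD[OF \<phi> _ _ that(3)] by (simp only: v')
    qed
    let ?m = "rank ?w (v y)"
    have y: "rep ?w ?m (v y)" using s by (simp add: rep_def)
    then obtain c where "c \<in> M" "rep ?w 0 c" "holds (v(i := v y, z := c)) \<phi>"
      using s by (auto simp: rep_def)
    then have "f (?m # ns) = 0" using sound[OF y] rep_fun by blast
    moreover have "f (m # ns) \<noteq> 0" if m: "m < ?m" for m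
    proof -
      \<comment> \<open>The formula speaks about labels only, so each smaller \<open>m\<close> must
        first be seen to have a label.\<close>
      have "m < card (numbers ?w)" using m rank_bound[OF w] s by (meson less_trans)
      then obtain b where b: "rep ?w m b" using rep_exists[OF w] by blast
      then have "lt b (v y)" "b \<in> numbers ?w"
        using rank_less_iff[OF w] s m by (auto simp: rep_def)
      then obtain c where "c \<in> M" "\<not> rep ?w 0 c" "holds (v(i := b, z := c)) \<phi>" using s by blast
      then show ?thesis using sound[OF b] by metis
    qed
    ultimately have "(LEAST y. f (y # ns) = 0) = ?m"
      by (intro Least_equality) (blast intro: leI)+
    then show "rep ?w (LEAST y. f (y # ns) = 0) (v y)" using y by simp
  next
    fix ns :: "nat list" assume ns: "length ns = length xs"
    define m where "m = (LEAST y. f (y # ns) = 0)"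
    have m: "f (m # ns) = 0" "\<And>j. j < m \<Longrightarrow> f (j # ns) \<noteq> 0"
      using tot[of ns] ns assms(3) LeastI_ex[of "\<lambda>y. f (y # ns) = 0"] not_less_Least
      by (auto simp: m_def)
    have "\<exists>N1. \<forall>N v. N \<ge> N1 \<longrightarrow> range v \<subseteq> M \<longrightarrow> frame N (v 2) \<longrightarrow>
      list_all2 (rep (v 2)) (j # ns) (map v (i # xs)) \<longrightarrow> rep (v 2) (f (j # ns)) (v z) \<longrightarrow> holds v \<phi>" for j
      using represents_completeD[OF \<phi>, of "j # ns"] ns by (metis length_Cons)
    then obtain N1 where N1: "\<And>j N v. N \<ge> N1 j \<Longrightarrow> range v \<subseteq> M \<Longrightarrow> frame N (v 2) \<Longrightarrow>
      list_all2 (rep (v 2)) (j # ns) (map v (i # xs)) \<Longrightarrow> rep (v 2) (f (j # ns)) (v z) \<Longrightarrow> holds v \<phi>"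
      by metis
    define N2 where "N2 = (\<Sum>j\<le>m. N1 j + Suc (f (j # ns)))"
    have N2: "N1 j + Suc (f (j # ns)) \<le> N2" if "j \<le> m" for j
      using that member_le_sum[of j "{..m}" "\<lambda>j. N1 j + Suc (f (j # ns))"] by (simp add: N2_def)
    have "holds v ?\<psi>" if v: "N \<ge> N2" "range v \<subseteq> M" "frame N (v 2)"
        "list_all2 (rep (v 2)) ns (map v xs)" "rep (v 2) m (v y)" for N v
    proof -
      let ?w = "v 2"
      have w: "?w \<in> M" using v(2) by auto
      have ex: "\<exists>c. rep ?w (f (j # ns)) c \<and> holds (v(i := b, z := c)) \<phi>"
        if jm: "rep ?w j b" "j \<le> m" for j b
      proof -
        have "f (j # ns) < N" using N2[OF jm(2)] v(1) by simp
        then obtain c where c: "rep ?w (f (j # ns)) c" using frame_rep[OF v(3)] by blast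
        let ?v = "v(i := b, z := c)"
        have "?v 2 = ?w" "?v i = b" "?v z = c" using ne[of 2] \<open>i \<noteq> z\<close> by auto
        moreover have "range ?v \<subseteq> M" using v(2) rep_in[OF c] rep_in[OF jm(1)] by auto
        ultimately have "holds ?v \<phi>"
          using N2[OF jm(2)] v jm(1) c
          by (intro N1[of j N ?v]) (simp_all only: list.map list_all2_Cons map simp_thms)
        then show ?thesis using c by blast
      qed
      show ?thesis unfolding sat[OF v(2)]
      proof (intro conjI ballI impI)
        show "v y \<in> numbers ?w" using v(5) by (simp add: rep_def)
        fix b assume b: "b \<in> numbers ?w"
        show "\<exists>c \<in> M. rep ?w 0 c \<and> holds (v(i := b, z := c)) \<phi>" if "b = v y"
          using ex[of m b] v(5) that m(1) rep_in by auto
        show "\<exists>c \<in> M. \<not> rep ?w 0 c \<and> holds (v(i := b, z := c)) \<phi>" if "lt b (v y)"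
        proof -
          have "rank ?w b < m" using rank_less_iff[OF w b] that v(5) by (auto simp: rep_def)
          then show ?thesis
            using ex[of "rank ?w b" b] b m(2)[of "rank ?w b"] rep_in rep_fun
            by (metis less_imp_le rep_def)
        qed
      qed
    qed
    then show "\<exists>N0. \<forall>N \<ge> N0. \<forall>v. range v \<subseteq> M \<longrightarrow> frame N (v 2) \<longrightarrow>
      list_all2 (rep (v 2)) ns (map v xs) \<longrightarrow> rep (v 2) (LEAST y. f (y # ns) = 0) (v y) \<longrightarrow>
      holds v ?\<psi>" unfolding m_def[symmetric] by blast
  qed
  then show ?thesis by blast
qed

theorem recfn_represented:
  "recfn n f \<Longrightarrow> length xs = n \<Longrightarrow> \<exists>\<phi>. represents \<phi> xs y f"
proof (induction arbitrary: xs y rule: recfn.induct)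
  case (r_zero n) then show ?case using represents_zero by blast
next
  case r_succ
  then obtain x where "xs = [x]" by (auto simp: length_Suc_conv)
  then show ?case using represents_suc by blast
next
  case (r_proj i n) then show ?case using represents_proj by blast
next
  case (r_comp m f gs n) then show ?case by (intro represents_comp) auto
next
  case (r_prim n f g) then show ?case by (intro represents_prim[of n]) auto
next
  case (r_mu n f) then show ?case by (intro represents_mu[of n]) auto
qed

end

section \<open>The diagonal sentence\<close>

text \<open>A function built by \<open>recfn\<close> has values on lists of every length, and the
  intended function need not share those at other lengths than \<open>n\<close>.\<close>

definition computable :: "nat \<Rightarrow> (nat list \<Rightarrow> nat) \<Rightarrow> bool" where
  "computable n h \<longleftrightarrow> (\<exists>f. recfn n f \<and> (\<forall>xs. length xs = n \<longrightarrow> f xs = h xs))"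

lemma computableI: "recfn n f \<Longrightarrow> (\<And>xs. length xs = n \<Longrightarrow> f xs = h xs) \<Longrightarrow> computable n h"
  unfolding computable_def by blast

lemma computable_proj: "i < n \<Longrightarrow> computable n (\<lambda>xs. xs ! i)"
  by (rule computableI[OF r_proj]) auto

lemma computable_comp1:
  assumes "computable 1 (\<lambda>xs. f (xs ! 0))" "computable n g"
  shows "computable n (\<lambda>xs. f (g xs))"
proof -
  obtain F G where F: "recfn 1 F" "\<And>xs. length xs = 1 \<Longrightarrow> F xs = f (xs ! 0)"
    and G: "recfn n G" "\<And>xs. length xs = n \<Longrightarrow> G xs = g xs"
    using assms unfolding computable_def by blast
  have "recfn n (\<lambda>xs. F (map (\<lambda>g. g xs) [G]))" using F(1) G(1) by (intro r_comp[of 1]) auto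
  then show ?thesis by (rule computableI) (use F(2) G(2) in auto)
qed

lemma computable_comp2:
  assumes "computable 2 (\<lambda>xs. f (xs ! 0) (xs ! 1))" "computable n g" "computable n h"
  shows "computable n (\<lambda>xs. f (g xs) (h xs))"
proof -
  obtain F G H where F: "recfn 2 F" "\<And>xs. length xs = 2 \<Longrightarrow> F xs = f (xs ! 0) (xs ! 1)"
    and G: "recfn n G" "\<And>xs. length xs = n \<Longrightarrow> G xs = g xs"
    and H: "recfn n H" "\<And>xs. length xs = n \<Longrightarrow> H xs = h xs"
    using assms unfolding computable_def by metis
  have "recfn n (\<lambda>xs. F (map (\<lambda>g. g xs) [G, H]))"
    using F(1) G(1) H(1) by (intro r_comp[of 2]) auto
  then show ?thesis by (rule computableI) (use F(2) G(2) H(2) in auto)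
qed

lemma computable_suc: "computable n g \<Longrightarrow> computable n (\<lambda>xs. Suc (g xs))"
  by (rule computable_comp1[of Suc], rule computableI[OF r_succ]) auto

lemma computable_const: "computable n (\<lambda>xs. c)"
  by (induction c) (auto intro: computableI[OF r_zero] computable_suc)

lemma computable_rec1:
  assumes "computable 2 (\<lambda>xs. g (xs ! 0) (xs ! 1))"
  shows "computable 1 (\<lambda>xs. rec_nat c g (xs ! 0))"
proof -
  obtain F where F: "recfn 0 F" "F [] = c"
    using computable_const[of 0 c] unfolding computable_def by auto
  obtain G where G: "recfn 2 G" "\<And>xs. length xs = 2 \<Longrightarrow> G xs = g (xs ! 0) (xs ! 1)"
    using assms unfolding computable_def by blast
  have "recfn 1 (\<lambda>xs. rec_nat (F (tl xs)) (\<lambda>y r. G (y # r # tl xs)) (hd xs))"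
    using r_prim[OF F(1), of G] G(1) by (simp add: numeral_2_eq_2)
  then show ?thesis
    by (rule computableI) (use F(2) G(2) in \<open>auto simp: length_Suc_conv numeral_2_eq_2\<close>)
qed

lemma computable_rec2:
  assumes "computable 3 (\<lambda>xs. g (xs ! 0) (xs ! 1) (xs ! 2))" "computable 1 (\<lambda>xs. f (xs ! 0))"
  shows "computable 2 (\<lambda>xs. rec_nat (f (xs ! 1)) (\<lambda>y r. g y r (xs ! 1)) (xs ! 0))"
proof -
  obtain F where F: "recfn 1 F" "\<And>xs. length xs = 1 \<Longrightarrow> F xs = f (xs ! 0)"
    using assms unfolding computable_def by blast
  obtain G where G: "recfn 3 G" "\<And>xs. length xs = 3 \<Longrightarrow> G xs = g (xs ! 0) (xs ! 1) (xs ! 2)"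
    using assms unfolding computable_def by blast
  have "recfn 2 (\<lambda>xs. rec_nat (F (tl xs)) (\<lambda>y r. G (y # r # tl xs)) (hd xs))"
    using r_prim[OF F(1), of G] G(1) by (simp add: numeral_2_eq_2 numeral_3_eq_3)
  then show ?thesis
    by (rule computableI)
      (use F(2) G(2) in \<open>auto simp: length_Suc_conv numeral_2_eq_2 numeral_3_eq_3\<close>)
qed

lemma computable_add:
  assumes "computable n g" "computable n h" shows "computable n (\<lambda>xs. g xs + h xs)"
proof -
  have "rec_nat b (\<lambda>y r. Suc r) a = a + b" for a b :: nat by (induction a) auto
  then have "computable 2 (\<lambda>xs. xs ! 0 + xs ! 1)"
    using computable_rec2[of "\<lambda>y r z. Suc r" "\<lambda>x. x"]
    by (simp add: computable_suc computable_proj)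
  then show ?thesis using assms by (rule computable_comp2)
qed

lemma computable_triangle:
  assumes "computable n g" shows "computable n (\<lambda>xs. triangle (g xs))"
proof -
  have "rec_nat 0 (\<lambda>y r. r + Suc y) a = triangle a" for a by (induction a) auto
  then have "computable 1 (\<lambda>xs. triangle (xs ! 0))"
    using computable_rec1[of "\<lambda>y r. r + Suc y" 0]
    by (simp add: computable_suc computable_proj computable_add)
  then show ?thesis using assms by (rule computable_comp1)
qed

lemma computable_pair:
  "computable n g \<Longrightarrow> computable n h \<Longrightarrow> computable n (\<lambda>xs. prod_encode (g xs, h xs))"
  by (simp add: prod_encode_def computable_add computable_triangle)

text \<open>Rebinding variable 0 as a copy of variable 1 takes the place of substitution. Each
  numeral wraps the previous one in a fixed context, so its code is computed by a simple
  recursion.\<close>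

primrec fm_numeral :: "nat \<Rightarrow> fm" where
  "fm_numeral 0 = fm_zero 2 0"
| "fm_numeral (Suc n) =
     Ex 1 (Conj (fm_suc 2 1 0) (Ex 0 (Conj (Eq (Var 0) (Var 1)) (fm_numeral n))))"

lemma freevars_numeral: "freevars (fm_numeral n) = {0, 2}"
  by (induction n) auto

lemma computable_numeral: "computable 1 (\<lambda>xs. enc_fm (fm_numeral (xs ! 0)))"
proof -
  define g where "g y r = prod_encode (4, prod_encode (1, prod_encode (3, prod_encode
    (enc_fm (fm_suc 2 1 0), prod_encode (4, prod_encode (0, prod_encode (3, prod_encode
      (enc_fm (Eq (Var 0) (Var 1)), r))))))))" for y r :: nat
  have "rec_nat (enc_fm (fm_zero 2 0)) g n = enc_fm (fm_numeral n)" for n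
    by (induction n) (auto simp: g_def)
  moreover have "computable 2 (\<lambda>xs. g (xs ! 0) (xs ! 1))"
    unfolding g_def by (intro computable_pair computable_const computable_proj) simp
  ultimately show ?thesis using computable_rec1[of g "enc_fm (fm_zero 2 0)"] by simp
qed

section \<open>Undecidability by diagonalization\<close>

context coding_frames
begin

lemma holds_numeral: "v 2 \<in> M \<Longrightarrow> holds v (fm_numeral n) \<longleftrightarrow> rep (v 2) n (v 0)"
proof (induction n arbitrary: v)
  case (Suc n)
  have "holds v (fm_numeral (Suc n)) \<longleftrightarrow>
      (\<exists>a \<in> M. (\<exists>k. rep (v 2) k a \<and> rep (v 2) (Suc k) (v 0)) \<and> rep (v 2) n a)"
    using Suc by (auto simp: holds_suc)
  also have "\<dots> \<longleftrightarrow> rep (v 2) (Suc n) (v 0)"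
  proof
    assume r: "rep (v 2) (Suc n) (v 0)"
    then have "n < card (numbers (v 2))"
      using rank_bound[OF Suc.prems, of "v 0"] by (simp add: rep_def)
    then obtain a where "rep (v 2) n a" using rep_exists[OF Suc.prems] by blast
    then show "\<exists>a \<in> M. (\<exists>k. rep (v 2) k a \<and> rep (v 2) (Suc k) (v 0)) \<and> rep (v 2) n a"
      using r rep_in by blast
  qed (auto dest: rep_fun)
  finally show ?case .
qed (simp add: holds_zero)

text \<open>The sentence \<open>S\<close> says that, over some \<open>w\<close>, the decision
  function takes the value 0 on \<open>S\<close> itself. Soundness in every \<open>w\<close> rules
  out false witnesses, and a large frame provides a true one.\<close>

theorem undecidable: "\<not> decidable_fms (Th M lt g1 g3)"
proof
  assume "decidable_fms (Th M lt g1 g3)"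
  then obtain f where f: "recfn 1 f"
    "\<And>\<phi>. f [enc_fm \<phi>] = (if \<phi> \<in> Th M lt g1 g3 then 1 else 0)"
    unfolding decidable_fms_def by blast
  \<comment> \<open>For the formula with code \<open>m\<close> this is the code of its diagonal
    sentence: the tags 4, 4, 3 stand for \<open>Ex 2\<close>, \<open>Ex 0\<close> and
    \<open>Conj\<close>. Quantifying over variable 0 with the numeral of \<open>m\<close> replaces
    substitution.\<close>
  define sub where "sub m = prod_encode (4, prod_encode (2, prod_encode (4, prod_encode (0,
    prod_encode (3, prod_encode (enc_fm (fm_numeral m), m))))))" for m
  have "computable 1 (\<lambda>xs. f [xs ! 0])"
    using f(1) by (rule computableI) (auto simp: length_Suc_conv)
  moreover have "computable 1 (\<lambda>xs. sub (xs ! 0))"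
    unfolding sub_def
    by (intro computable_pair computable_const computable_proj computable_numeral) simp
  ultimately have "computable 1 (\<lambda>xs. f [sub (xs ! 0)])"
    by (rule computable_comp1[of "\<lambda>x. f [x]"])
  then obtain h where h: "recfn 1 h" "\<And>m. h [m] = f [sub m]"
    unfolding computable_def by force
  obtain \<phi> where \<phi>: "represents \<phi> [0] 1 h" using recfn_represented[OF h(1), of "[0]" 1] by auto
  define \<psi> where "\<psi> = Ex 1 (Conj (fm_zero 2 1) \<phi>)"
  define m where "m = enc_fm \<psi>"
  define S where "S = Ex 2 (Ex 0 (Conj (fm_numeral m) \<psi>))"
  have enc: "enc_fm S = sub m" by (simp add: S_def sub_def m_def)
  have "sentence S"
    using \<phi> by (auto simp: sentence_def S_def \<psi>_def freevars_numeral represents_def)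
  have "holds v S \<longleftrightarrow> h [m] = 0" if v: "range v \<subseteq> M" for v
  proof
    assume "holds v S"
    then obtain w a b where abw: "w \<in> M" "a \<in> M" "b \<in> M" "holds (v(2 := w, 0 := a)) (fm_numeral m)"
      "holds (v(2 := w, 0 := a, 1 := b)) (fm_zero 2 1)" "holds (v(2 := w, 0 := a, 1 := b)) \<phi>"
      by (auto simp: S_def \<psi>_def)
    have M: "range (v(2 := w, 0 := a, 1 := b)) \<subseteq> M" using v abw by auto
    have "rep w m a" "rep w 0 b" using abw by (simp_all add: holds_numeral holds_zero)
    moreover have "rep w (h [m]) b"
      using represents_soundD[OF \<phi> M _ abw(6), of "[m]"] \<open>rep w m a\<close> by simp
    ultimately show "h [m] = 0" using rep_fun by blast
  next
    assume hm: "h [m] = 0"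
    obtain N0 where N0: "\<And>N v. N \<ge> N0 \<Longrightarrow> range v \<subseteq> M \<Longrightarrow> frame N (v 2) \<Longrightarrow>
      list_all2 (rep (v 2)) [m] (map v [0]) \<Longrightarrow> rep (v 2) (h [m]) (v 1) \<Longrightarrow> holds v \<phi>"
      using represents_completeD[OF \<phi>, of "[m]"] by auto
    obtain N w where N: "N > N0 + m" "frame N w" using frames by blast
    then have "m < N" "0 < N" by auto
    then obtain a b where ab: "rep w m a" "rep w 0 b" using frame_rep[OF N(2)] by metis
    have M: "range (v(2 := w, 0 := a, 1 := b)) \<subseteq> M"
      using v frame_in[OF N(2)] rep_in ab by auto
    have "holds (v(2 := w, 0 := a, 1 := b)) \<phi>"
      using N ab hm by (intro N0[OF _ M, of N]) auto
    then show "holds v S"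
      using ab rep_in frame_in[OF N(2)]
      by (simp add: S_def \<psi>_def holds_numeral holds_zero) blast
  qed
  \<comment> \<open>\<open>Th\<close> quantifies over assignments into \<open>M\<close>; a member of
    \<open>M\<close> keeps this from being vacuous.\<close>
  moreover obtain w where "w \<in> M" using frames frame_in by blast
  ultimately have "S \<in> Th M lt g1 g3 \<longleftrightarrow> h [m] = 0"
    using \<open>sentence S\<close> unfolding Th_def by (auto simp: image_subset_iff intro: exI[of _ "\<lambda>_. w"])
  then show False using f(2)[of S] enc h(2)[of m] by (auto split: if_splits)
qed

end

section \<open>Realizing label sequences by words\<close>

lemma Node_append_less [simp]: "Node (xs @ ys) < Node (xs @ zs) \<longleftrightarrow> Node ys < Node zs"
  by (induction xs) auto

lemma join_snoc_append: "join n (ps @ [p @ q]) = join n (ps @ [p]) @ q"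
proof (induction ps)
  case (Cons r ps) then show ?case by (cases ps) auto
qed simp

section \<open>Branches and labels, written with the symbols 2 and 3\<close>

definition threes :: "nat list \<Rightarrow> word" where
  "threes cs = join 2 (map (\<lambda>c. replicate c 3) cs)"

text \<open>\<open>c\<close> symbols 3 separate \<open>Suc c\<close> empty pieces, each of value
  \<open>Node []\<close>.\<close>

definition val3 :: "nat \<Rightarrow> tree" where
  "val3 c = Node (replicate (Suc c) (Node []))"

lemma val3_less_iff [simp]: "val3 a < val3 b \<longleftrightarrow> a < b"
proof -
  have "val3 a < val3 b" if "a < b" for a b
  proof -
    have "replicate (Suc b) (Node []) =
        replicate (Suc a) (Node []) @ Node [] # replicate (b - Suc a) (Node [])"
      using that by (simp add: replicate_app_Cons_same flip: replicate_add replicate_Suc)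
    then show ?thesis unfolding val3_def by (metis Node_less_snoc)
  qed
  then show ?thesis by (metis less_asym less_irrefl linorder_neqE_nat)
qed

lemma val3_le_iff [simp]: "val3 a \<le> val3 b \<longleftrightarrow> a \<le> b"
  by (simp flip: not_less)

lemma replicate_3:
  "NF (replicate c 3)" "set (replicate c (3::nat)) \<subseteq> {3..<3 + 1}"
  "val 1 3 (replicate c 3) = val3 c"
proof -
  have j: "join 3 (replicate (Suc c) []) = replicate c 3"
  proof (induction c)
    case (Suc c) then show ?case by (simp add: join_Cons)
  qed simp
  have "descending (replicate k t)" for k and t :: tree by (induction k) auto
  then have d: "descending (map (val 0 (Suc 3)) (replicate (Suc c) []))" by (simp del: replicate_Suc)
  have p: "\<forall>p \<in> set (replicate (Suc c) []). NF p \<and> set p \<subseteq> {Suc 3..<Suc 3 + 0}"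
    using NF_Nil by auto
  show "NF (replicate c 3)" "set (replicate c (3::nat)) \<subseteq> {3..<3 + 1}" "val 1 3 (replicate c 3) = val3 c"
    using NF_join[OF _ p d] unfolding j by (auto simp: val3_def simp del: val.simps(2))
qed

lemma threes_NF:
  assumes "cs \<noteq> []" "descending cs"
  shows "NF (threes cs)" "set (threes cs) \<subseteq> {2..<2 + 2}" "val 2 2 (threes cs) = Node (map val3 cs)"
proof -
  let ?ps = "map (\<lambda>c. replicate c 3) cs"
  have m: "map (val 1 (Suc 2)) ?ps = map val3 cs"
    using replicate_3(3) by (auto simp: numeral_3_eq_3 numeral_2_eq_2 simp del: val.simps)
  have d: "descending (map (val 1 (Suc 2)) ?ps)"
    unfolding m using assms(2) by (simp add: sorted_wrt_map)
  have p: "\<forall>p \<in> set ?ps. NF p \<and> set p \<subseteq> {Suc 2..<Suc 2 + 1}"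
    using replicate_3(1) by auto
  show "NF (threes cs)" "set (threes cs) \<subseteq> {2..<2 + 2}" "val 2 2 (threes cs) = Node (map val3 cs)"
    using NF_join[OF _ p d] assms(1) unfolding threes_def[symmetric] m
    by (auto simp: Suc_1[symmetric] simp del: val.simps(2) Suc_1)
qed

definition down :: "nat \<Rightarrow> nat \<Rightarrow> nat list" where
  "down n i = rev [i..<Suc n]"

lemma down_append: "i \<le> j \<Longrightarrow> j \<le> Suc n \<Longrightarrow> down n i = down n j @ rev [i..<j]"
  unfolding down_def by (metis le_Suc_ex rev_append upt_add_eq_append)

lemma down_Suc: "i < j \<Longrightarrow> j \<le> Suc n \<Longrightarrow> down n i = down n j @ (j - 1) # rev [i..<j - 1]"
  using down_append[of i j n] by (cases j) auto

lemma descending_down: "descending (down n i)"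
  by (simp add: down_def sorted_wrt_rev del: upt_Suc)

text \<open>In terms of exponents of \<open>3\<close>, \<open>branch n i\<close> is the descending sequence \<open>n, n - 1, \<dots>, i\<close>;
  appending \<open>3\<close> gives \<open>label n i\<close>, the sequence \<open>n, \<dots>, i + 1, i + 1\<close>. Every branch lies below
  every label, so applying \<open>\<Diamond>\<^sub>3\<close> to a word that is built from branches erases all but
  the last branch.\<close>

definition branch :: "nat \<Rightarrow> nat \<Rightarrow> word" where
  "branch n i = threes (down n i)"

definition label :: "nat \<Rightarrow> nat \<Rightarrow> word" where
  "label n i = branch n i @ [3]"

lemma label_eq: "i \<le> n \<Longrightarrow> label n i = threes (down n (Suc i) @ [Suc i])"
  using down_Suc[of i "Suc i" n]
  by (simp add: label_def branch_def threes_def join_snoc_append flip: replicate_append_same)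

lemma branch_NF:
  assumes "i \<le> n"
  shows "NF (branch n i)" "set (branch n i) \<subseteq> {2..<2 + 2}"
    "val 2 2 (branch n i) = Node (map val3 (down n i))"
proof -
  have "down n i \<noteq> []" using assms by (simp add: down_def)
  then show "NF (branch n i)" "set (branch n i) \<subseteq> {2..<2 + 2}"
    "val 2 2 (branch n i) = Node (map val3 (down n i))"
    using threes_NF[OF _ descending_down] unfolding branch_def by blast+
qed

lemma label_NF:
  assumes "i \<le> n"
  shows "NF (label n i)" "set (label n i) \<subseteq> {2..<2 + 2}"
    "val 2 2 (label n i) = Node (map val3 (down n (Suc i) @ [Suc i]))"
proof -
  have "descending (down n (Suc i) @ [Suc i])"
    using descending_down[of n "Suc i"] by (auto simp: sorted_wrt_append down_def)
  then show "NF (label n i)" "set (label n i) \<subseteq> {2..<2 + 2}"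
    "val 2 2 (label n i) = Node (map val3 (down n (Suc i) @ [Suc i]))"
    using threes_NF[of "down n (Suc i) @ [Suc i]"] unfolding label_eq[OF assms] by blast+
qed

text \<open>The smaller index prolongs the descending sequence, so one branch is a proper prefix of
  the other.\<close>

lemma branch_less: "j < i \<Longrightarrow> i \<le> n \<Longrightarrow> val 2 2 (branch n i) < val 2 2 (branch n j)"
  by (simp add: branch_NF down_Suc[of j i] Node_less_snoc del: val.simps)

lemma branch_le_0: "i \<le> n \<Longrightarrow> val 2 2 (branch n i) \<le> val 2 2 (branch n 0)"
  using branch_less[of 0 i n] by (cases i) (auto simp del: val.simps)

text \<open>Either the first difference has \<open>i\<close> in the branch against
  \<open>Suc i\<close> in the label, or the branch is a proper prefix of the label.\<close>

lemma branch_less_label: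
  assumes "i \<le> n" "j \<le> n" shows "val 2 2 (branch n j) < val 2 2 (label n i)"
proof (cases "j \<le> i")
  case True
  then show ?thesis
    using assms by (simp add: branch_NF label_NF down_Suc[of j "Suc i"] del: val.simps)
next
  case False
  then have "down n (Suc i) @ [Suc i] = down n j @ rev [Suc i..<j] @ [Suc i]"
    using assms down_append[of "Suc i" j n] by simp
  moreover obtain x xs where "rev [Suc i..<j] @ [Suc i] = x # xs"
    by (cases "rev [Suc i..<j] @ [Suc i]") auto
  ultimately show ?thesis
    using assms by (simp add: branch_NF label_NF Node_less_snoc del: val.simps)
qed

text \<open>At the first difference the entries are \<open>j\<close> and
  \<open>Suc j\<close>.\<close>

lemma label_less:
  assumes "i < j" "j \<le> n" shows "val 2 2 (label n i) < val 2 2 (label n j)"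
  using assms by (simp add: label_NF down_Suc[of "Suc i" "Suc j"] del: val.simps)

text \<open>Here \<open>m\<close> is the counter and \<open>i\<close> carries the label. The padding
  is the largest branch, so the components descend and blocks are compared by \<open>m\<close>
  regardless of \<open>i\<close>.\<close>

definition block :: "nat \<Rightarrow> nat \<Rightarrow> nat \<Rightarrow> word" where
  "block n m i = join 1 (replicate m (branch n 0) @ [branch n i])"

lemma block_NF:
  assumes "i \<le> n"
  shows "NF (block n m i)" "set (block n m i) \<subseteq> {1..<1 + 3}"
    "split_at_sym 1 (block n m i) = replicate m (branch n 0) @ [branch n i]"
    "val 3 1 (block n m i) = Node (replicate m (val 2 2 (branch n 0)) @ [val 2 2 (branch n i)])"
proof -
  let ?ps = "replicate m (branch n 0) @ [branch n i]"
  have p: "\<forall>p \<in> set ?ps. NF p \<and> set p \<subseteq> {Suc 1..<Suc 1 + 2}"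
    using branch_NF(1,2)[OF assms] branch_NF(1,2)[of 0 n] by (auto simp: numeral_2_eq_2)
  have m: "map (val 2 (Suc 1)) ?ps = replicate m (val 2 2 (branch n 0)) @ [val 2 2 (branch n i)]"
    by (simp only: map_append map_replicate list.map Suc_1)
  have "descending (map (val 2 (Suc 1)) ?ps)"
    unfolding m using branch_le_0[OF assms] by (induction m) (auto simp del: val.simps)
  note J = NF_join[OF _ p this, unfolded m]
  show "NF (block n m i)" "set (block n m i) \<subseteq> {1..<1 + 3}"
    "split_at_sym 1 (block n m i) = replicate m (branch n 0) @ [branch n i]"
    "val 3 1 (block n m i) = Node (replicate m (val 2 2 (branch n 0)) @ [val 2 2 (branch n i)])"
    using J unfolding block_def by (auto simp: numeral_3_eq_3 numeral_2_eq_2 simp del: val.simps)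
qed

text \<open>Where the shorter padding ends, \<open>branch n i\<close> meets the maximal
  \<open>branch n 0\<close>; in case of a tie the block with the smaller counter is a proper
  prefix.\<close>

lemma block_less:
  assumes "i \<le> n" "j \<le> n" "k < m"
  shows "val 3 1 (block n k i) < val 3 1 (block n m j)"
proof -
  let ?b = "val 2 2 (branch n 0)"
  have "replicate m ?b = replicate k ?b @ ?b # replicate (m - Suc k) ?b"
    using assms(3) by (simp add: replicate_app_Cons_same flip: replicate_add replicate_Suc)
  moreover obtain x xs where "replicate (m - Suc k) ?b @ [val 2 2 (branch n j)] = x # xs"
    by (cases "replicate (m - Suc k) ?b @ [val 2 2 (branch n j)]") auto
  ultimately have "val 3 1 (block n m j) = Node (replicate k ?b @ ?b # x # xs)"
    unfolding block_NF(4)[OF assms(2)] by simp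
  then show ?thesis
    unfolding block_NF(4)[OF assms(1)] using branch_le_0[OF assms(1)]
    by (cases "val 2 2 (branch n i) = ?b") (simp_all del: val.simps)
qed

text \<open>The appended 3 turns the last branch into a label, which exceeds all branches and so
  erases the padding and with it the counter.\<close>

lemma block_snoc_3:
  assumes "i \<le> n"
  shows "val 3 1 (block n m i @ [3]) = Node [val 2 2 (label n i)]"
proof -
  have split: "split_at_sym 1 (block n m i @ [3]) = replicate m (branch n 0) @ [label n i]"
    using assms by (simp add: split_snoc_other block_NF label_def del: One_nat_def)
  have "\<not> val 2 2 (label n i) \<le> val 2 2 (branch n 0)"
    using branch_less_label[OF assms, of 0] by (simp del: val.simps)
  then have fil: "filter (\<lambda>x. val 2 2 (label n i) \<le> x) (lexmax (replicate m (val 2 2 (branch n 0)))) = []"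
    using set_lexmax by (fastforce simp: filter_empty_conv simp del: val.simps)
  have "val (Suc 2) 1 (block n m i @ [3]) =
      Node (lexmax (replicate m (val 2 2 (branch n 0)) @ [val 2 2 (label n i)]))"
    by (simp only: val.simps split map_append map_replicate list.map Suc_1)
  then show ?thesis by (simp add: lexmax_snoc fil del: val.simps)
qed

text \<open>Using the number of remaining entries as counter makes the blocks descend for every
  \<open>L\<close>, repetitions included.\<close>

fun blocks :: "nat \<Rightarrow> nat list \<Rightarrow> word list" where
  "blocks n [] = []"
| "blocks n (i # L) = block n (length L) i # blocks n L"

lemma length_blocks [simp]: "length (blocks n L) = length L"
  by (induction L) auto

lemma nth_blocks: "j < length L \<Longrightarrow> blocks n L ! j = block n (length L - Suc j) (L ! j)"
  by (induction L arbitrary: j) (auto simp: nth_Cons split: nat.split)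

lemma set_blocks: "set L \<subseteq> {..n} \<Longrightarrow> p \<in> set (blocks n L) \<Longrightarrow>
    \<exists>m i. m < length L \<and> i \<le> n \<and> p = block n m i"
proof (induction L)
  case (Cons i L)
  show ?case
  proof (cases "p = block n (length L) i")
    case True then show ?thesis using Cons.prems by (intro exI[of _ "length L"] exI[of _ i]) auto
  next
    case False
    then obtain m k where "m < length L" "k \<le> n" "p = block n m k" using Cons by auto
    then show ?thesis by (intro exI[of _ m] exI[of _ k]) auto
  qed
qed simp

lemma descending_blocks: "set L \<subseteq> {..n} \<Longrightarrow> descending (map (val 3 1) (blocks n L))"
proof (induction L)
  case (Cons i L)
  have "val 3 1 p \<le> val 3 1 (block n (length L) i)" if "p \<in> set (blocks n L)" for p
    using set_blocks[OF _ that] Cons.prems block_less[of _ n i] by (fastforce simp del: val.simps)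
  then show ?case using Cons by (auto simp del: val.simps)
qed simp

definition block_word :: "nat \<Rightarrow> nat list \<Rightarrow> nat \<Rightarrow> word" where
  "block_word n L j = join 0 (take j (blocks n L))"

lemma block_word_NF:
  assumes "set L \<subseteq> {..n}" "0 < j" "j \<le> length L"
  shows "NF (block_word n L j)" "set (block_word n L j) \<subseteq> {0..<0 + 4}"
    "split_at_sym 0 (block_word n L j) = take j (blocks n L)"
    "val 4 0 (block_word n L j) = Node (take j (map (val 3 1) (blocks n L)))"
proof -
  let ?ps = "take j (blocks n L)"
  have p: "\<forall>p \<in> set ?ps. NF p \<and> set p \<subseteq> {Suc 0..<Suc 0 + 3}"
  proof
    fix p assume "p \<in> set ?ps"
    then obtain m i where "i \<le> n" "p = block n m i"
      using set_blocks[OF assms(1)] in_set_takeD by metis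
    then show "NF p \<and> set p \<subseteq> {Suc 0..<Suc 0 + 3}"
      using block_NF(1,2)[of i n m] by simp
  qed
  have "descending (map (val 3 (Suc 0)) ?ps)"
    using descending_blocks[OF assms(1)] by (simp add: sorted_wrt_take flip: take_map del: val.simps)
  note J = NF_join[OF _ p this]
  have "length ?ps = j" using assms by simp
  then have "?ps \<noteq> []" using assms(2) by (metis length_greater_0_conv)
  then show "NF (block_word n L j)" "set (block_word n L j) \<subseteq> {0..<0 + 4}"
    "split_at_sym 0 (block_word n L j) = take j (blocks n L)"
    "val 4 0 (block_word n L j) = Node (take j (map (val 3 1) (blocks n L)))"
    using J unfolding block_word_def by (simp_all add: take_map del: val.simps)
qed

lemma block_word_less:
  assumes "set L \<subseteq> {..n}" "0 < j" "j < k" "k \<le> length L"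
  shows "wless (block_word n L j) (block_word n L k)"
proof -
  let ?vs = "map (val 3 1) (blocks n L)"
  have "take k ?vs = take j ?vs @ ?vs ! j # drop (Suc j) (take k ?vs)"
    using assms id_take_nth_drop[of j "take k ?vs"] by (simp add: min_def del: val.simps)
  then have "Node (take j ?vs) < Node (take k ?vs)" by (metis Node_less_snoc)
  then show ?thesis
    using assms block_word_NF(2,4)[of L n]
    by (subst wless_iff_val[of _ 0 4]) (simp_all del: val.simps)
qed

lemma block_word_less_iff:
  assumes "set L \<subseteq> {..n}" "j \<in> {0<..length L}" "k \<in> {0<..length L}"
  shows "wless (block_word n L j) (block_word n L k) \<longleftrightarrow> j < k"
  using assms block_word_less[OF assms(1)] wless_linear(1,2)
  by (metis greaterThanAtMost_iff linorder_neqE_nat)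

text \<open>Erasure happens on two levels: the label erases the padding of the last block, and the
  resulting singleton exceeds all earlier blocks, which consist of branches. What is left has
  neither 0 nor 1, so position and counter leave no trace.\<close>

lemma block_word_diam3:
  assumes "set L \<subseteq> {..n}" "0 < j" "j \<le> length L"
  shows "diam 3 (block_word n L j) = label n (L ! (j - 1))"
proof (rule diam_eqI)
  define i where "i = L ! (j - 1)"
  have "i \<in> set L" using assms(2,3) by (simp add: i_def)
  then have i: "i \<le> n" using assms(1) by auto
  let ?ps = "take j (blocks n L)"
  let ?t = "Node [val 2 2 (label n i)]"
  show "NF (block_word n L j)" "set (block_word n L j) \<subseteq> {0..<0 + 4}" "(3::nat) < 4"
    using block_word_NF[OF assms] by auto
  show "NF (label n (L ! (j - 1)))" "set (label n (L ! (j - 1))) \<subseteq> {0..<0 + 4}"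
    using label_NF[OF i] by (auto simp: i_def)
  have len: "length ?ps = j" using assms by simp
  then have "last ?ps = ?ps ! (j - 1)" using assms(2) by (metis last_conv_nth length_greater_0_conv)
  also have "\<dots> = block n (length L - j) i"
    using assms(2,3) nth_blocks[of "j - 1" L n] by (simp add: i_def)
  finally have "last ?ps = block n (length L - j) i" .
  then have lst: "val 3 1 (last ?ps @ [3]) = ?t" by (simp only: block_snoc_3[OF i])
  have "\<not> ?t \<le> val 3 1 p" if "p \<in> set ?ps" for p
  proof -
    obtain m k where k: "k \<le> n" "p = block n m k"
      using set_blocks[OF assms(1)] \<open>p \<in> set ?ps\<close> in_set_takeD by metis
    have "val 3 1 p < ?t"
      unfolding k(2) block_NF(4)[OF k(1)]
      using branch_less_label[OF i, of 0] branch_less_label[OF i k(1)]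
      by (cases m) (simp_all del: val.simps)
    then show ?thesis by (simp del: Node_le_simps val.simps)
  qed
  then have fil: "filter (\<lambda>x. ?t \<le> x) (lexmax (map (val 3 1) (butlast ?ps))) = []"
    using set_lexmax by (fastforce simp: filter_empty_conv dest: in_set_butlastD
      simp del: val.simps Node_le_simps)
  have "split_at_sym 0 (block_word n L j @ [3]) = butlast ?ps @ [last ?ps @ [3]]"
    using block_word_NF(3)[OF assms] by (simp add: split_snoc_other)
  then have "val (Suc 3) 0 (block_word n L j @ [3]) =
      Node (lexmax (map (val 3 1) (butlast ?ps) @ [val 3 1 (last ?ps @ [3])]))"
    by (simp only: val.simps map_append list.map One_nat_def)
  also have "\<dots> = Node [?t]" unfolding lst lexmax_snoc fil by simp
  also have "\<dots> = val (Suc (Suc 2)) 0 (label n i)"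
  proof -
    have z: "0 \<notin> set (label n i)" "Suc 0 \<notin> set (label n i)" using label_NF(2)[OF i] by auto
    show ?thesis by (simp only: val_notin[OF z(1)] val_notin[OF z(2)] flip: numeral_2_eq_2)
  qed
  finally show "val 4 0 (label n (L ! (j - 1))) = val 4 0 (block_word n L j @ [3])"
    by (simp add: i_def del: val.simps)
qed

section \<open>Frames among the normal forms\<close>

definition adjacent :: "'a list \<Rightarrow> 'a \<Rightarrow> 'a \<Rightarrow> bool" where
  "adjacent xs a b \<longleftrightarrow> (\<exists>k. Suc k < length xs \<and> xs ! k = a \<and> xs ! Suc k = b)"

lemma adjacent_in_set: "adjacent xs a b \<Longrightarrow> a \<in> set xs \<and> b \<in> set xs"
  by (auto simp: adjacent_def)

lemma adjacent_simps [simp]: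
  "\<not> adjacent [x] a b"
  "adjacent (x # y # zs) a b \<longleftrightarrow> x = a \<and> y = b \<or> adjacent (y # zs) a b"
proof -
  show "adjacent (x # y # zs) a b \<longleftrightarrow> x = a \<and> y = b \<or> adjacent (y # zs) a b" (is "?l \<longleftrightarrow> ?r")
  proof
    assume ?l
    then obtain k where "Suc k < length (x # y # zs)" "(x # y # zs) ! k = a"
      "(x # y # zs) ! Suc k = b" unfolding adjacent_def by blast
    then show ?r unfolding adjacent_def by (cases k) auto
  next
    assume ?r
    then show ?l
    proof
      assume "adjacent (y # zs) a b"
      then obtain k where "Suc k < length (y # zs)" "(y # zs) ! k = a" "(y # zs) ! Suc k = b"
        unfolding adjacent_def by blast
      then show ?l unfolding adjacent_def by (intro exI[of _ "Suc k"]) auto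
    qed (auto simp: adjacent_def)
  qed
qed (simp add: adjacent_def)

text \<open>With 0 around each pair, neighbours that do not form one of the pairs include a
  0.\<close>

lemma adjacent_pairs:
  fixes a b :: nat
  assumes "a \<noteq> 0" "b \<noteq> 0"
  shows "adjacent (0 # concat (map (\<lambda>(i, j). [i, j, 0]) ps)) a b \<longleftrightarrow> (a, b) \<in> set ps"
  using assms by (induction ps) auto

context
  fixes \<alpha> :: enat
  assumes \<alpha>: "\<alpha> \<ge> 3"
begin

interpretation coding_structure "WN \<alpha>" wless "diam 1" "diam 3" .

lemma WN_I: "NF w \<Longrightarrow> set w \<subseteq> {0..<0 + 4} \<Longrightarrow> w \<in> WN \<alpha>"
proof -
  assume "NF w" "set w \<subseteq> {0..<0 + 4}"
  moreover have "enat x \<le> \<alpha>" if "x < 4" for x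
  proof -
    have "enat x \<le> enat 3" using that by simp
    then show ?thesis using \<alpha> by (metis numeral_eq_enat order_trans)
  qed
  ultimately show ?thesis unfolding WN_def W_def by auto
qed

lemma interval_eq:
  "x \<in> WN \<alpha> \<Longrightarrow> interval x = {p \<in> WN \<alpha>. prefix (split_at_sym 0 p) (split_at_sym 0 x)}"
  unfolding interval_def using between_diam1_iff by (auto simp: WN_def)

lemma interval_block_word:
  assumes "set L \<subseteq> {..n}" "L \<noteq> []"
  shows "interval (block_word n L (length L)) = block_word n L ` {0<..length L}"
proof -
  let ?x = "block_word n L (length L)"
  have len: "0 < length L" using assms(2) by simp
  have s: "split_at_sym 0 ?x = blocks n L"
    using block_word_NF(3)[OF assms(1) len] by simp
  have "?x \<in> WN \<alpha>" using block_word_NF[OF assms(1) len] by (intro WN_I) auto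
  note int = interval_eq[OF this, unfolded s]
  show ?thesis
  proof
    show "interval ?x \<subseteq> block_word n L ` {0<..length L}"
    proof
      fix p assume "p \<in> interval ?x"
      then have p: "prefix (split_at_sym 0 p) (blocks n L)" unfolding int by blast
      let ?j = "length (split_at_sym 0 p)"
      have "split_at_sym 0 p = take ?j (blocks n L)" using p by (metis append_eq_conv_conj prefix_def)
      then have "p = block_word n L ?j" unfolding block_word_def by (metis join_split)
      moreover have "?j \<in> {0<..length L}" using prefix_length_le[OF p] by simp
      ultimately show "p \<in> block_word n L ` {0<..length L}" by blast
    qed
    show "block_word n L ` {0<..length L} \<subseteq> interval ?x"
    proof
      fix p assume "p \<in> block_word n L ` {0<..length L}"
      then obtain j where "p = block_word n L j" "0 < j" "j \<le> length L" by auto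
      then show "p \<in> interval ?x"
        unfolding int using block_word_NF[OF assms(1), of j] WN_I take_is_prefix by auto
    qed
  qed
qed

lemma numbers_block_word:
  assumes "set L \<subseteq> {..n}" "L \<noteq> []"
  shows "numbers (block_word n L (length L)) = label n ` set L"
proof -
  \<comment> \<open>Segments are indexed by length, which starts at 1, hence the shift when
    \<open>L\<close> is accessed.\<close>
  have "numbers (block_word n L (length L)) = (\<lambda>j. label n (L ! (j - 1))) ` {0<..length L}"
    unfolding numbers_def interval_block_word[OF assms] image_image
    using block_word_diam3[OF assms(1)] by (intro image_cong) auto
  also have "{0<..length L} = Suc ` {..<length L}"
    by (auto simp: image_iff gr0_conv_Suc Suc_le_eq)
  also have "(\<lambda>j. label n (L ! (j - 1))) ` Suc ` {..<length L} = label n ` set L"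
    by (auto simp: image_image in_set_conv_nth intro!: imageI)
  finally show ?thesis .
qed

lemma rel_block_word:
  assumes "set L \<subseteq> {..n}" "L \<noteq> []"
  shows "rel (block_word n L (length L)) u v \<longleftrightarrow> (\<exists>a b. adjacent L a b \<and> u = label n a \<and> v = label n b)"
proof -
  let ?J = "{0<..length L}"
  have "rel (block_word n L (length L)) u v \<longleftrightarrow> (\<exists>j \<in> ?J. \<exists>k \<in> ?J. j < k \<and>
      \<not> (\<exists>s \<in> ?J. j < s \<and> s < k) \<and> u = label n (L ! (j - 1)) \<and> v = label n (L ! (k - 1)))"
    unfolding rel_def interval_block_word[OF assms] bex_simps
    using block_word_less_iff[OF assms(1)] block_word_diam3[OF assms(1)] by (auto simp: Bex_def)
  also have "\<dots> \<longleftrightarrow> (\<exists>j. Suc j < length L \<and> u = label n (L ! j) \<and> v = label n (L ! Suc j))"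
  proof
    assume "\<exists>j \<in> ?J. \<exists>k \<in> ?J. j < k \<and>
      \<not> (\<exists>s \<in> ?J. j < s \<and> s < k) \<and> u = label n (L ! (j - 1)) \<and> v = label n (L ! (k - 1))"
    then obtain j k where jk: "j \<in> ?J" "k \<in> ?J" "j < k" "\<not> (\<exists>s \<in> ?J. j < s \<and> s < k)"
      "u = label n (L ! (j - 1))" "v = label n (L ! (k - 1))" by blast
    have "k = Suc j"
    proof (rule ccontr)
      assume "k \<noteq> Suc j"
      then show False using jk(1-4) by (auto dest: bspec[of _ _ "Suc j"])
    qed
    then show "\<exists>j. Suc j < length L \<and> u = label n (L ! j) \<and> v = label n (L ! Suc j)"
      using jk by (intro exI[of _ "j - 1"]) auto
  next
    assume "\<exists>j. Suc j < length L \<and> u = label n (L ! j) \<and> v = label n (L ! Suc j)"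
    then obtain j where "Suc j < length L" "u = label n (L ! j)" "v = label n (L ! Suc j)" by blast
    then show "\<exists>j \<in> ?J. \<exists>k \<in> ?J. j < k \<and>
      \<not> (\<exists>s \<in> ?J. j < s \<and> s < k) \<and> u = label n (L ! (j - 1)) \<and> v = label n (L ! (k - 1))"
      by (intro bexI[of _ "Suc j"] bexI[of _ "Suc (Suc j)"]) auto
  qed
  finally show ?thesis unfolding adjacent_def by blast
qed

lemma inj_on_label: "inj_on (label n) {..n}"
proof (rule inj_onI)
  fix i j assume "i \<in> {..n}" "j \<in> {..n}" "label n i = label n j"
  then show "i = j"
    using label_less[of i j n] label_less[of j i n]
    by (cases i j rule: linorder_cases) (auto simp del: val.simps)
qed

text \<open>The numbers take the indices from 1 on; index 0 is reserved for separating pairs in the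
  elements that code relations.\<close>

lemma frame_block_word:
  assumes "0 < n"
  shows "frame n (block_word n [1..<Suc n] n)"
proof -
  let ?L = "[1..<Suc n]"
  have L: "set ?L \<subseteq> {..n}" "?L \<noteq> []" "length ?L = n" using assms by auto
  have num: "numbers (block_word n ?L n) = label n ` {1..n}"
    using numbers_block_word[OF L(1,2)] unfolding L(3) by (simp add: atLeastLessThanSuc_atLeastAtMost del: upt_Suc)
  show ?thesis unfolding frame_def num
  proof (intro conjI allI impI)
    show "block_word n ?L n \<in> WN \<alpha>" using block_word_NF[OF L(1) assms] L(3) by (intro WN_I) auto
    have "inj_on (label n) {1..n}" using inj_on_label by (rule inj_on_subset) auto
    then show "card (label n ` {1..n}) = n" by (simp add: card_image)
    fix P assume "P \<subseteq> label n ` {1..n} \<times> label n ` {1..n}"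
    have "finite {(a, b) \<in> {1..n} \<times> {1..n}. (label n a, label n b) \<in> P}"
      by (rule finite_subset[of _ "{1..n} \<times> {1..n}"]) auto
    then obtain ps where
      ps: "set ps = {(a, b) \<in> {1..n} \<times> {1..n}. (label n a, label n b) \<in> P}"
      using finite_list by blast
    \<comment> \<open>The leading 0 keeps the list nonempty even for empty \<open>P\<close>.
      Neighbours that involve 0 yield pairs with \<open>label n 0\<close>, which is not a number of
      the frame.\<close>
    let ?K = "0 # concat (map (\<lambda>(i, j). [i, j, 0]) ps)"
    have K: "set ?K \<subseteq> {..n}" using ps by auto
    have "rel (block_word n ?K (length ?K)) i r \<longleftrightarrow> (i, r) \<in> P"
      if ir: "i \<in> label n ` {1..n}" "r \<in> label n ` {1..n}" for i r
    proof -
      obtain a b where ab: "a \<in> {1..n}" "b \<in> {1..n}" "i = label n a" "r = label n b"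
        using ir by blast
      have "rel (block_word n ?K (length ?K)) i r \<longleftrightarrow>
          (\<exists>a' b'. adjacent ?K a' b' \<and> label n a = label n a' \<and> label n b = label n b')"
        unfolding rel_block_word[OF K list.distinct(2)] ab(3,4) ..
      also have "\<dots> \<longleftrightarrow> adjacent ?K a b"
      proof -
        have "label n c = label n c' \<longleftrightarrow> c = c'" if "c \<in> {1..n}" "c' \<in> set ?K" for c c'
          using inj_on_eq_iff[OF inj_on_label, of c n c'] that K by auto
        then show ?thesis using adjacent_in_set[of ?K] ab(1,2) by blast
      qed
      also have "\<dots> \<longleftrightarrow> (a, b) \<in> set ps" using ab by (intro adjacent_pairs) auto
      finally show ?thesis using ps ab by auto
    qed
    moreover have "block_word n ?K (length ?K) \<in> WN \<alpha>" using block_word_NF[OF K] by (intro WN_I) auto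
    ultimately show "\<exists>x \<in> WN \<alpha>. \<forall>i \<in> label n ` {1..n}. \<forall>r \<in> label n ` {1..n}.
        rel x i r \<longleftrightarrow> (i, r) \<in> P" by blast
  qed
qed

lemma coding_frames_WN: "coding_frames (WN \<alpha>) wless (diam 1) (diam 3)"
proof
  show "\<not> wless a a" for a by (rule wless_linear)
  show "wless a b \<Longrightarrow> wless b c \<Longrightarrow> wless a c" for a b c by (rule wless_linear)
  show "a \<in> WN \<alpha> \<Longrightarrow> b \<in> WN \<alpha> \<Longrightarrow> a \<noteq> b \<Longrightarrow> wless a b \<or> wless b a" for a b
    using wless_linear(3) by (auto simp: WN_def)
  have "enat 3 \<le> \<alpha>" using \<alpha> by (simp add: numeral_eq_enat)
  then show "a \<in> WN \<alpha> \<Longrightarrow> diam 3 a \<in> WN \<alpha>" for a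
    using diam_NF(1,2)[of a 3] by (auto simp: WN_def W_def)
  show "finite (interval x)" if "x \<in> WN \<alpha>" for x
  proof (rule finite_subset)
    show "interval x \<subseteq> join 0 ` set (prefixes (split_at_sym 0 x))"
    proof
      fix p assume "p \<in> interval x"
      then have "split_at_sym 0 p \<in> set (prefixes (split_at_sym 0 x))"
        unfolding interval_eq[OF that] by simp
      then show "p \<in> join 0 ` set (prefixes (split_at_sym 0 x))"
        using rev_image_eqI[of "split_at_sym 0 p" _ p "join 0"] by simp
    qed
  qed simp
  show "\<exists>N > n. \<exists>w. frame N w" for n
    using frame_block_word[of "Suc n"] by blast
qed

end

theorem theorem1:
  fixes \<alpha> :: enat
  assumes "\<alpha> \<ge> 3"
  shows "\<not> decidable_fms (Th (WN \<alpha>) wless (diam 1) (diam 3))"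
  using assms by (intro coding_frames.undecidable coding_frames_WN)

end
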